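(* Let $\Omega\subset\mathbb{R}^N$ be a bounded domain and $\psi:\partial\Omega\to\mathbb{R}$ a continuous function such that $(\Omega,\psi)$ satisfies a bounded slope condition. Let $f:[0,+\infty)\to\mathbb{R}$ be strictly convex, $f\in C^1([0,+\infty))\cap C^{2,\lambda}_{loc}((0,+\infty))$ with $0<\lambda<1$, $f'(0)>0$, and suppose that $\rho f''(\rho)/f'(\rho)$ has finite limits as $\rho\to0^+$ and $\rho\to+\infty$, with $\lim_{\rho\to+\infty}\rho f''(\rho)/f'(\rho)>0$. Then the solution $u$ of $$\min\Big\{\int_\Omega f(|\nabla w|)\,dx:\ w\in\mathrm{Lip}(\overline\Omega),\ w=\psi\text{ on }\partial\Omega\Big\}$$ is a viscosity solution of $$-\big[\alpha(|\nabla u|)-1\big]\Delta_\infty u-|\nabla u|^2\Delta u=0\quad\text{in }\Omega,$$ where $\alpha(\rho)=\dfrac{\rho f''(\rho)}{f'(\rho)}$ for $\rho>0$ and $\alpha(0)=0$.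
   Context: $\mathrm{Lip}(\overline\Omega)$ is the space of Lipschitz continuous functions on $\overline\Omega$. $\Delta_\infty u=\langle\nabla^2u\,\nabla u,\nabla u\rangle=\sum_{i,j}u_{x_i}u_{x_j}u_{x_ix_j}$ is the infinity-Laplacian. Viscosity solutions are meant in the usual (Crandall–Ishii–Lions) sense. The pair $(\Omega,\psi)$ satisfies a bounded slope condition (with constant $Q>0$) if for every $x_0\in\partial\Omega$ there exist two affine functions $L^+,L^-$ such that $L^-\le\psi\le L^+$ on $\partial\Omega$, $L^-(x_0)=\psi(x_0)=L^+(x_0)$, and $\sup_{x,y\in\Omega,\,x\ne y}\frac{|L^\pm(x)-L^\pm(y)|}{|x-y|}\le Q$. Under these assumptions the minimum problem has a unique solution. *)

theory Defs
  imports "HOL-Analysis.Analysis"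
begin

section \<open>Functions of one real variable\<close>

definition strictly_convex_on :: "real set \<Rightarrow> (real \<Rightarrow> real) \<Rightarrow> bool" where
  "strictly_convex_on I f \<longleftrightarrow> convex I \<and>
     (\<forall>x\<in>I. \<forall>y\<in>I. \<forall>t. x \<noteq> y \<and> 0 < t \<and> t < 1 \<longrightarrow>
        f ((1 - t) * x + t * y) < (1 - t) * f x + t * f y)"

definition locally_holder_on :: "real \<Rightarrow> real set \<Rightarrow> (real \<Rightarrow> real) \<Rightarrow> bool" where
  "locally_holder_on lam I g \<longleftrightarrow>
     (\<forall>K. compact K \<and> K \<subseteq> I \<longrightarrow>
        (\<exists>C. \<forall>x\<in>K. \<forall>y\<in>K. \<bar>g x - g y\<bar> \<le> C * \<bar>x - y\<bar> powr lam))"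

definition alpha :: "(real \<Rightarrow> real) \<Rightarrow> (real \<Rightarrow> real) \<Rightarrow> real \<Rightarrow> real" where
  "alpha f' f'' r = (if r > 0 then r * f'' r / f' r else 0)"


section \<open>Gradient and Hessian\<close>

definition gradient :: "(real^'n \<Rightarrow> real) \<Rightarrow> real^'n \<Rightarrow> real^'n" where
  "gradient w x = (if w differentiable (at x) then (THE D. GDERIV w x :> D) else 0)"

lemma gradient_eqI:
  assumes "GDERIV w x :> D"
  shows "gradient w x = D"
proof -
  have unique: "E = D" if "GDERIV w x :> E" for E
  proof -
    have "(\<lambda>h. h \<bullet> E) = (\<lambda>h. h \<bullet> D)"
      by (rule has_derivative_unique[OF that[unfolded gderiv_def] assms[unfolded gderiv_def]])
    then have "\<forall>h. h \<bullet> E = h \<bullet> D"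
      by (simp add: fun_eq_iff)
    then show "E = D"
      by (simp only: vector_eq_ldot)
  qed
  have "w differentiable (at x)"
    by (rule differentiableI[OF assms[unfolded gderiv_def]])
  moreover have "(THE D. GDERIV w x :> D) = D"
    using assms unique by (rule the_equality)
  ultimately show ?thesis
    by (simp add: gradient_def)
qed

definition hessian :: "(real^'n \<Rightarrow> real) \<Rightarrow> real^'n \<Rightarrow> real^'n^'n" where
  "hessian w x = jacobian (gradient w) (at x)"

text \<open>Twice continuously differentiable; meant for open sets \<open>S\<close> only.\<close>

definition C2_on :: "(real^'n) set \<Rightarrow> (real^'n \<Rightarrow> real) \<Rightarrow> bool" where
  "C2_on S w \<longleftrightarrow>
     (\<forall>x\<in>S. w differentiable (at x) \<and> gradient w differentiable (at x)) \<and>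
     continuous_on S (hessian w)"


section \<open>Viscosity solutions\<close>

definition upper_semicontinuous_on :: "'a::topological_space set \<Rightarrow> ('a \<Rightarrow> real) \<Rightarrow> bool" where
  "upper_semicontinuous_on S u \<longleftrightarrow>
     (\<forall>x\<in>S. \<forall>c > u x. eventually (\<lambda>y. u y < c) (at x within S))"

definition lower_semicontinuous_on :: "'a::topological_space set \<Rightarrow> ('a \<Rightarrow> real) \<Rightarrow> bool" where
  "lower_semicontinuous_on S u \<longleftrightarrow>
     (\<forall>x\<in>S. \<forall>c < u x. eventually (\<lambda>y. c < u y) (at x within S))"

definition local_max_in :: "'a::topological_space set \<Rightarrow> ('a \<Rightarrow> real) \<Rightarrow> 'a \<Rightarrow> bool" where
  "local_max_in S g x \<longleftrightarrow> x \<in> S \<and> eventually (\<lambda>y. g y \<le> g x) (at x within S)"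

definition local_min_in :: "'a::topological_space set \<Rightarrow> ('a \<Rightarrow> real) \<Rightarrow> 'a \<Rightarrow> bool" where
  "local_min_in S g x \<longleftrightarrow> x \<in> S \<and> eventually (\<lambda>y. g x \<le> g y) (at x within S)"

text \<open>
  Equations \<open>F(\<nabla>u, \<nabla>\<^sup>2u) = 0\<close> in an open set \<open>S\<close>, for continuous \<open>F\<close> that is degenerate
  elliptic in the sign convention \<open>X \<le> Y \<Longrightarrow> F p Y \<le> F p X\<close> (for example \<open>F p X = - trace X\<close>).
\<close>

definition viscosity_subsolution ::
  "(real^'n) set \<Rightarrow> (real^'n \<Rightarrow> real^'n^'n \<Rightarrow> real) \<Rightarrow> (real^'n \<Rightarrow> real) \<Rightarrow> bool" where
  "viscosity_subsolution S F u \<longleftrightarrow> upper_semicontinuous_on S u \<and>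
     (\<forall>phi x. C2_on S phi \<and> local_max_in S (\<lambda>y. u y - phi y) x \<longrightarrow>
        F (gradient phi x) (hessian phi x) \<le> 0)"

definition viscosity_supersolution ::
  "(real^'n) set \<Rightarrow> (real^'n \<Rightarrow> real^'n^'n \<Rightarrow> real) \<Rightarrow> (real^'n \<Rightarrow> real) \<Rightarrow> bool" where
  "viscosity_supersolution S F u \<longleftrightarrow> lower_semicontinuous_on S u \<and>
     (\<forall>phi x. C2_on S phi \<and> local_min_in S (\<lambda>y. u y - phi y) x \<longrightarrow>
        F (gradient phi x) (hessian phi x) \<ge> 0)"

definition viscosity_solution ::
  "(real^'n) set \<Rightarrow> (real^'n \<Rightarrow> real^'n^'n \<Rightarrow> real) \<Rightarrow> (real^'n \<Rightarrow> real) \<Rightarrow> bool" where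
  "viscosity_solution S F u \<longleftrightarrow>
     viscosity_subsolution S F u \<and> viscosity_supersolution S F u"


section \<open>The minimum problem\<close>

definition bounded_slope_condition ::
  "real \<Rightarrow> (real^'n) set \<Rightarrow> (real^'n \<Rightarrow> real) \<Rightarrow> bool" where
  "bounded_slope_condition Q S psi \<longleftrightarrow>
     (\<forall>x0\<in>frontier S. \<exists>Lp Lm.
        (\<exists>a b. Lp = (\<lambda>x. a \<bullet> x + b)) \<and> (\<exists>a b. Lm = (\<lambda>x. a \<bullet> x + b)) \<and>
        (\<forall>x\<in>frontier S. Lm x \<le> psi x \<and> psi x \<le> Lp x) \<and>
        Lm x0 = psi x0 \<and> psi x0 = Lp x0 \<and>
        (\<forall>x\<in>S. \<forall>y\<in>S. x \<noteq> y \<longrightarrow>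
           \<bar>Lp x - Lp y\<bar> / norm (x - y) \<le> Q \<and> \<bar>Lm x - Lm y\<bar> / norm (x - y) \<le> Q))"

text \<open>
  Functions on \<open>closure S\<close> are represented by total functions whose values outside
  \<open>closure S\<close> are irrelevant: nothing below depends on them when \<open>S\<close> is open.
\<close>

definition lip_competitors :: "(real^'n) set \<Rightarrow> (real^'n \<Rightarrow> real) \<Rightarrow> (real^'n \<Rightarrow> real) set" where
  "lip_competitors S psi =
     {w. (\<exists>C. C-lipschitz_on (closure S) w) \<and> (\<forall>x\<in>frontier S. w x = psi x)}"

text \<open>
  By Rademacher's theorem a Lipschitz \<open>w\<close> is differentiable almost everywhere on the open set
  \<open>S\<close>, so the value \<open>0\<close> of \<open>gradient\<close> at other points plays no role. For bounded \<open>S\<close> and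
  \<open>f\<close> continuous on \<open>{0..}\<close> the integrand is then bounded and measurable, hence integrable.
\<close>

definition energy :: "(real \<Rightarrow> real) \<Rightarrow> (real^'n) set \<Rightarrow> (real^'n \<Rightarrow> real) \<Rightarrow> real" where
  "energy f S w = (LINT x:S|lebesgue. f (norm (gradient w x)))"

definition solves_min_problem ::
  "(real \<Rightarrow> real) \<Rightarrow> (real^'n) set \<Rightarrow> (real^'n \<Rightarrow> real) \<Rightarrow> (real^'n \<Rightarrow> real) \<Rightarrow> bool" where
  "solves_min_problem f S psi u \<longleftrightarrow> u \<in> lip_competitors S psi \<and>
     (\<forall>w\<in>lip_competitors S psi. energy f S u \<le> energy f S w)"

end

theory Submission
  imports Defs
begin

text \<open>
  The equation degenerates at \<open>\<nabla>\<phi> = 0\<close>: both terms carry factors of the gradient, so a test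
  function with vanishing gradient at the touching point satisfies it trivially. All the work is
  at touching points with \<open>p = \<nabla>\<phi>(x\<^sub>0) \<noteq> 0\<close>. There \<open>f\<close> is twice continuously differentiable near
  \<open>|p|\<close>, and the equation is, up to the negative factor \<open>- f'(|\<nabla>u|) / |\<nabla>u|\<^sup>3\<close>, the Euler--Lagrange
  equation \<open>div G(\<nabla>u) = 0\<close> for the flux \<open>G(a) = f'(|a|) a / |a|\<close>.

  Suppose a minimiser \<open>u\<close> is touched from above at \<open>x\<^sub>0\<close> by a function that violates the
  subsolution inequality. By Taylor's formula the test function may be replaced by a quadratic
  polynomial \<open>P\<close> that touches \<open>u\<close> strictly, with \<open>div G(\<nabla>P) \<le> -c < 0\<close> in a small ball around \<open>x\<^sub>0\<close>.
  Cut the graph of \<open>u\<close> off at a slightly lowered \<open>P\<close>: for small \<open>\<delta> > 0\<close> the function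
  \<open>v = (u - P + \<delta>)\<^sup>+\<close> lives in the ball, and \<open>w = u - v\<close> is a competitor, equal to \<open>P - \<delta>\<close> where
  \<open>v > 0\<close>. Convexity of \<open>a \<mapsto> f(|a|)\<close> gives, almost everywhere,
  \<open>f(|\<nabla>u|) \<ge> f(|\<nabla>w|) + G(\<nabla>P) \<bullet> \<nabla>v\<close>, and integrating by parts
  \<open>\<integral> G(\<nabla>P) \<bullet> \<nabla>v = - \<integral> v div G(\<nabla>P) \<ge> c \<integral> v > 0\<close>. So \<open>w\<close> has strictly less energy than \<open>u\<close>, which is
  absurd. This is \<open>minimizer_touched_from_above\<close>. The supersolution property follows because
  \<open>-u\<close> minimises the same energy with boundary values \<open>-\<psi>\<close> and the equation is odd.

  Competitors are merely Lipschitz, and the energy only sees the points at which they are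
  differentiable. Hence the argument rests on Rademacher's theorem, \<open>AE_differentiable_if_lipschitz\<close>.
  Its one-dimensional core is a Vitali covering argument: on the set where a bi-Lipschitz
  monotone \<open>g\<close> has arbitrarily small intervals of slope below \<open>p\<close> and of slope above \<open>q > p\<close>, the
  length of the image is at most \<open>p\<close> times and at least \<open>q\<close> times the length, so the set is null.
  Fubini's theorem along lines transfers this to directional derivatives; their additivity
  holds almost everywhere because the exceptional set meets every line of one fixed direction in
  a countable set. Once gradients exist, integration by parts (\<open>weak_divergence_theorem\<close>) reduces to
  \<open>\<integral> \<partial>\<^sub>e h = 0\<close> for compactly supported Lipschitz \<open>h\<close>, by dominated convergence of difference quotients,
  whose integrals vanish by translation invariance.
\<close>

section \<open>Differentiability of Lipschitz functions on the line\<close>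

text \<open>
  Intervals of slope at most \<open>p\<close> inside an open \<open>U \<supseteq> T\<close> form a Vitali cover of \<open>T\<close>, and a disjoint
  countable subfamily exhausts \<open>T\<close> up to a null set, whose image is null as \<open>g\<close> is Lipschitz. The
  images of the chosen intervals have total length at most \<open>p\<close> times that of \<open>U\<close>, and \<open>U\<close> may be
  taken with measure close to that of \<open>T\<close>.
\<close>

lemma emeasure_image_le_if_slopes_le:
  fixes g :: "real \<Rightarrow> real"
  assumes "mono g" "B-lipschitz_on UNIV g" "T \<in> sets borel" "g ` T \<in> sets borel" "0 \<le> p"
    and slope: "\<And>x d. x \<in> T \<Longrightarrow> 0 < d \<Longrightarrow>
      \<exists>y z. y < z \<and> z - y < d \<and> x \<in> {y..z} \<and> g z - g y \<le> p * (z - y)"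
  shows "emeasure lborel (g ` T) \<le> ennreal p * emeasure lborel T"
proof -
  have upper: "emeasure lborel (g ` T) \<le> ennreal p * emeasure lborel U" if "open U" "T \<subseteq> U" for U
  proof -
    define K where "K = {i :: real \<times> real. 0 < snd i \<and> cball (fst i) (snd i) \<subseteq> U \<and>
      g (fst i + snd i) - g (fst i - snd i) \<le> p * ((fst i + snd i) - (fst i - snd i))}"
    obtain C where C: "countable C" "C \<subseteq> K"
      and disj: "pairwise (\<lambda>i j. disjnt (cball (fst i) (snd i)) (cball (fst j) (snd j))) C"
      and neg: "negligible (T - (\<Union>i\<in>C. cball (fst i) (snd i)))"
    proof (rule Vitali_covering_theorem_cballs[of K snd T fst])
      show "0 < snd i" if "i \<in> K" for i using that by (simp add: K_def)
      fix x d :: real assume x: "x \<in> T" and d: "0 < d"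
      obtain e where e: "e > 0" "ball x e \<subseteq> U"
        using \<open>open U\<close> x \<open>T \<subseteq> U\<close> by (meson openE subsetD)
      obtain y z where yz: "y < z" "z - y < min e d" "x \<in> {y..z}" "g z - g y \<le> p * (z - y)"
        using slope[OF x, of "min e d"] e d by auto
      have *: "(y + z) / 2 + (z - y) / 2 = z" "(y + z) / 2 - (z - y) / 2 = y"
        by (simp_all add: field_simps)
      have **: "cball ((y + z) / 2) ((z - y) / 2) = {y..z}"
        unfolding cball_eq_atLeastAtMost using * by simp
      have "{y..z} \<subseteq> U" using e(2) yz by (auto simp: dist_real_def subset_iff)
      then have "((y + z) / 2, (z - y) / 2) \<in> K"
        unfolding K_def mem_Collect_eq fst_conv snd_conv * ** using yz by simp
      then show "\<exists>i. i \<in> K \<and> x \<in> cball (fst i) (snd i) \<and> snd i < d"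
        using yz d by (intro exI[of _ "((y + z) / 2, (z - y) / 2)"]) (simp add: **)
    qed auto
    define A where "A n = (if n \<in> to_nat_on C ` C
        then cball (fst (from_nat_into C n)) (snd (from_nat_into C n)) else {})" for n
    define H where "H n = (if n \<in> to_nat_on C ` C
        then {g (fst (from_nat_into C n) - snd (from_nat_into C n)) ..
              g (fst (from_nat_into C n) + snd (from_nat_into C n))} else {})" for n
    have inC: "from_nat_into C n \<in> C" if "n \<in> to_nat_on C ` C" for n
      using that C by auto
    have UA: "(\<Union>i\<in>C. cball (fst i) (snd i)) = (\<Union>n. A n)"
      using C by (auto simp: A_def split: if_splits)
    have "disjoint_family A"
    proof (unfold disjoint_family_on_def, intro ballI impI)
      fix m n :: nat assume "m \<noteq> n"
      show "A m \<inter> A n = {}"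
      proof (cases "m \<in> to_nat_on C ` C \<and> n \<in> to_nat_on C ` C")
        case True
        then have "from_nat_into C m \<noteq> from_nat_into C n"
          using \<open>m \<noteq> n\<close> C by auto
        then show ?thesis using True disj inC by (auto simp: A_def pairwise_def disjnt_def)
      qed (auto simp: A_def)
    qed
    have AU: "(\<Union>n. A n) \<subseteq> U" using C unfolding UA[symmetric] K_def by auto
    have gA: "g ` A n \<subseteq> H n" for n
      using \<open>mono g\<close> by (auto simp: A_def H_def cball_eq_atLeastAtMost mono_def)
    have HA: "emeasure lborel (H n) \<le> ennreal p * emeasure lborel (A n)" for n
    proof (cases "n \<in> to_nat_on C ` C")
      case True
      then have *: "from_nat_into C n \<in> K" using inC C by auto
      then show ?thesis using True \<open>mono g\<close> \<open>0 \<le> p\<close>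
        by (simp add: A_def H_def cball_eq_atLeastAtMost mono_def K_def
            ennreal_mult[symmetric] ennreal_leI)
    qed (simp add: H_def)
    let ?N = "T - (\<Union>n. A n)"
    have "negligible (g ` ?N)"
    proof (rule negligible_locally_Lipschitz_image)
      show "negligible ?N" using neg UA by simp
      fix x show "\<exists>V b. open V \<and> x \<in> V \<and> (\<forall>y\<in>?N \<inter> V. norm (g y - g x) \<le> b * norm (y - x))"
        using lipschitz_on_normD[OF assms(2)] by (intro exI[of _ UNIV] exI[of _ B]) auto
    qed simp
    then have N0: "emeasure lebesgue (g ` ?N) = 0" and Nm: "g ` ?N \<in> sets lebesgue"
      by (auto simp: negligible_iff_null_sets)
    have Hm: "H n \<in> sets lebesgue" for n by (simp add: H_def)
    have "emeasure lborel (g ` T) = emeasure lebesgue (g ` T)" using assms by simp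
    also have "\<dots> \<le> emeasure lebesgue (g ` ?N \<union> (\<Union>n. H n))"
      using gA Nm Hm by (intro emeasure_mono) (auto, blast)
    also have "\<dots> \<le> emeasure lebesgue (g ` ?N) + emeasure lebesgue (\<Union>n. H n)"
      using Nm Hm by (intro emeasure_subadditive) auto
    also have "\<dots> \<le> (\<Sum>n. emeasure lebesgue (H n))"
      using emeasure_subadditive_countably[of H lebesgue] Hm unfolding N0 by auto
    also have "\<dots> \<le> (\<Sum>n. ennreal p * emeasure lborel (A n))"
      using HA by (intro suminf_le) (auto simp: H_def)
    also have "\<dots> = ennreal p * (\<Sum>n. emeasure lborel (A n))" by simp
    also have "(\<Sum>n. emeasure lborel (A n)) = emeasure lborel (\<Union>n. A n)"
      using \<open>disjoint_family A\<close> by (intro suminf_emeasure \<open>disjoint_family A\<close>) (auto simp: A_def)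
    also have "ennreal p * emeasure lborel (\<Union>n. A n) \<le> ennreal p * emeasure lborel U"
      using AU \<open>open U\<close> by (intro mult_left_mono emeasure_mono) auto
    finally show ?thesis .
  qed
  show ?thesis
  proof (rule ennreal_le_epsilon)
    fix e :: real assume "0 < e"
    then obtain U where U: "open U" "T \<subseteq> U" "emeasure lborel (U - T) < e / (p + 1)"
      using outer_regular_lborel[OF \<open>T \<in> sets borel\<close>, of "e / (p + 1)"] \<open>0 \<le> p\<close> by auto
    have "emeasure lborel U \<le> emeasure lborel T + emeasure lborel (U - T)"
      using U assms(3) emeasure_subadditive[of T lborel "U - T"]
      by (simp add: Un_absorb1)
    then have "emeasure lborel U \<le> emeasure lborel T + ennreal (e / (p + 1))"
      using U(3) by (meson add_left_mono less_imp_le order_trans)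
    then have "ennreal p * emeasure lborel U \<le> ennreal p * (emeasure lborel T + ennreal (e / (p + 1)))"
      by (rule mult_left_mono) simp
    also have "\<dots> = ennreal p * emeasure lborel T + ennreal (p * (e / (p + 1)))"
      using \<open>0 \<le> p\<close> \<open>0 < e\<close> by (simp add: distrib_left ennreal_mult[symmetric])
    also have "\<dots> \<le> ennreal p * emeasure lborel T + ennreal e"
      using \<open>0 \<le> p\<close> \<open>0 < e\<close> by (intro add_left_mono ennreal_leI) (simp add: field_simps)
    finally show "emeasure lborel (g ` T) \<le> ennreal p * emeasure lborel T + ennreal e"
      using upper[OF U(1,2)] by (rule order_trans[rotated])
  qed
qed


text \<open>
  The points at which the difference quotients of \<open>v\<close> in direction \<open>e\<close> have lower limit below \<open>p\<close> and
  upper limit above \<open>q\<close>, up to boundary cases. Witnesses at every scale \<open>1 / Suc n\<close>, in place of a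
  statement about limits, make the set visibly a countable intersection of open sets.
\<close>

definition oscillating_slopes ::
  "('a::real_normed_vector \<Rightarrow> real) \<Rightarrow> 'a \<Rightarrow> real \<Rightarrow> real \<Rightarrow> 'a set" where
  "oscillating_slopes v e p q = {x. \<forall>n::nat.
     (\<exists>t. 0 < \<bar>t\<bar> \<and> \<bar>t\<bar> < 1 / Suc n \<and> (v (x + t *\<^sub>R e) - v x) / t < p) \<and>
     (\<exists>t. 0 < \<bar>t\<bar> \<and> \<bar>t\<bar> < 1 / Suc n \<and> q < (v (x + t *\<^sub>R e) - v x) / t)}"

lemma oscillating_slopes_borel:
  fixes v :: "'a::real_normed_vector \<Rightarrow> real"
  assumes "continuous_on UNIV v"
  shows "oscillating_slopes v e p q \<in> sets borel"
proof -
  have cont: "continuous_on UNIV (\<lambda>x. (v (x + t *\<^sub>R e) - v x) / t)" for t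
    by (cases "t = 0") (auto intro!: continuous_intros continuous_on_compose2[OF assms])
  let ?A = "\<lambda>n::nat.
      (\<Union>t\<in>{t. 0 < \<bar>t\<bar> \<and> \<bar>t\<bar> < 1 / Suc n}. {x. (v (x + t *\<^sub>R e) - v x) / t < p}) \<inter>
      (\<Union>t\<in>{t. 0 < \<bar>t\<bar> \<and> \<bar>t\<bar> < 1 / Suc n}. {x. q < (v (x + t *\<^sub>R e) - v x) / t})"
  have "open {x. (v (x + t *\<^sub>R e) - v x) / t < p}"
    "open {x. q < (v (x + t *\<^sub>R e) - v x) / t}" for t
    by (auto intro!: open_Collect_less cont)
  then have "open (?A n)" for n by (intro open_Int open_UN ballI)
  then have "(\<Inter>n. ?A n) \<in> sets borel"
    by (intro sets.countable_INT image_subsetI borel_open) auto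
  moreover have "oscillating_slopes v e p q = (\<Inter>n. ?A n)"
    by (auto simp: oscillating_slopes_def)
  ultimately show ?thesis by simp
qed

text \<open>
  The covering estimate applied to a monotone function bounds the image of the set by \<open>p\<close> times
  its length; applied to the inverse function, it bounds the length by \<open>1/q\<close> times that of the image.
  With \<open>p < q\<close> this forces length \<open>0\<close>.
\<close>

lemma oscillating_slopes_null_real:
  fixes h :: "real \<Rightarrow> real"
  assumes lip: "L-lipschitz_on UNIV h" and "p < q"
  shows "emeasure lborel (oscillating_slopes h 1 p q) = 0"
proof -
  \<comment> \<open>The added linear term puts all slopes into \<open>[1, 2L + 1]\<close>, so that \<open>g\<close> and its inverse are both
    increasing and Lipschitz, and shifts \<open>p\<close> and \<open>q\<close> by the same amount.\<close>
  define g where "g x = h x + (L + 1) * x" for x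
  have "0 \<le> L" using lip by (rule lipschitz_on_nonneg)
  have h: "\<bar>h x - h y\<bar> \<le> L * \<bar>x - y\<bar>" for x y
    using lipschitz_on_normD[OF lip, of x y] by simp
  have g_lower: "z - y \<le> g z - g y" if "y \<le> z" for y z
    using h[of z y] that by (simp add: g_def algebra_simps abs_le_iff)
  have g_upper: "g z - g y \<le> (2 * L + 1) * (z - y)" if "y \<le> z" for y z
    using h[of z y] that by (simp add: g_def algebra_simps abs_le_iff)
  have g_mono: "mono g"
    by (rule monoI) (use g_lower in force)
  have g_less: "g y < g z \<longleftrightarrow> y < z" for y z
    using g_lower[of y z] g_lower[of z y] by linarith
  have "inj g" by (rule injI) (metis g_less less_irrefl linorder_neqE)
  have g_lip: "(2 * L + 1)-lipschitz_on UNIV g"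
  proof (rule lipschitz_onI)
    show "dist (g x) (g y) \<le> (2 * L + 1) * dist x y" for x y
      using g_upper[of x y] g_upper[of y x] g_lower[of x y] g_lower[of y x]
      by (cases "x \<le> y") (auto simp: dist_real_def abs_if)
  qed (use \<open>0 \<le> L\<close> in auto)
  have g_cont: "continuous_on S g" for S
    using lipschitz_on_continuous_on[OF g_lip] continuous_on_subset by blast
  have "surj g"
  proof (rule surjI[of g "\<lambda>y. SOME x. g x = y"], rule someI_ex)
    fix y
    let ?a = "\<bar>y - g 0\<bar>"
    have "\<exists>x. - ?a \<le> x \<and> x \<le> ?a \<and> g x = y"
      using g_lower[of 0 ?a] g_lower[of "- ?a" 0] by (intro IVT' g_cont) auto
    then show "\<exists>x. g x = y" by blast
  qed
  define k where "k = inv g"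
  have kg [simp]: "k (g x) = x" for x using \<open>inj g\<close> by (simp add: k_def)
  have gk [simp]: "g (k y) = y" for y using \<open>surj g\<close> by (simp add: k_def surj_f_inv_f)
  have k_mono: "mono k"
    by (rule monoI) (metis g_less gk linorder_not_less)
  have k_lip: "1-lipschitz_on UNIV k"
  proof (rule lipschitz_onI)
    show "dist (k x) (k y) \<le> 1 * dist x y" for x y
      using g_lower[of "k x" "k y"] g_lower[of "k y" "k x"]
      by (cases "k x \<le> k y") (auto simp: dist_real_def)
  qed auto
  have k_cont: "continuous_on UNIV k"
    using lipschitz_on_continuous_on[OF k_lip] .
  let ?E = "oscillating_slopes h 1 p q"
  have E: "?E \<in> sets borel"
    by (rule oscillating_slopes_borel) (rule lipschitz_on_continuous_on[OF lip])
  have g_slope: "(g (x + t) - g x) / t = (h (x + t) - h x) / t + (L + 1)" if "t \<noteq> 0" for x t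
    using that by (simp add: g_def field_simps)
  have slopes_at: "(\<exists>t. 0 < \<bar>t\<bar> \<and> \<bar>t\<bar> < d \<and> (g (x + t) - g x) / t < p + (L + 1)) \<and>
      (\<exists>t. 0 < \<bar>t\<bar> \<and> \<bar>t\<bar> < d \<and> q + (L + 1) < (g (x + t) - g x) / t)"
    if "x \<in> ?E" "0 < d" for x d
  proof -
    obtain n :: nat where n: "1 / Suc n < d" using \<open>0 < d\<close> nat_approx_posE by blast
    from \<open>x \<in> ?E\<close>[unfolded oscillating_slopes_def mem_Collect_eq, rule_format, of n]
    obtain s t where st: "0 < \<bar>s\<bar>" "\<bar>s\<bar> < d" "(h (x + s) - h x) / s < p"
      "0 < \<bar>t\<bar>" "\<bar>t\<bar> < d" "q < (h (x + t) - h x) / t"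
      using n by (auto simp del: of_nat_Suc)
    have "(g (x + s) - g x) / s < p + (L + 1)" using st g_slope[of s x] by simp
    moreover have "q + (L + 1) < (g (x + t) - g x) / t" using st g_slope[of t x] by simp
    ultimately show ?thesis using st by blast
  qed
  let ?p = "p + (L + 1)" and ?q = "q + (L + 1)"
  have slope_ge: "1 \<le> (g (x + t) - g x) / t" if "t \<noteq> 0" for x t
    using that g_lower[of x "x + t"] g_lower[of "x + t" x] by (cases "0 < t") (auto simp: field_simps)
  \<comment> \<open>A bounded part has finite measure, which is what allows cancelling it in \<open>q m \<le> p m\<close>.\<close>
  have bounded_part: "emeasure lborel (?E \<inter> {- real n .. real n}) = 0" for n
  proof (cases "?E = {}")
    case False
    let ?T = "?E \<inter> {- real n .. real n}"
    have T: "?T \<in> sets borel" using E by simp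
    obtain x where "x \<in> ?E" using False by blast
    from slopes_at[OF this, of 1] slope_ge[of _ x] have "0 < ?p" by force
    then have "0 < ?q" using \<open>p < q\<close> by simp
    have "g ` ?T = k -` ?T"
    proof (intro equalityI subsetI)
      fix y assume "y \<in> k -` ?T"
      then show "y \<in> g ` ?T" by (intro image_eqI[of y g "k y"]) auto
    qed auto
    then have gT: "g ` ?T \<in> sets borel"
      using measurable_sets[OF borel_measurable_continuous_onI[OF k_cont] T] by simp
    have le1: "emeasure lborel (g ` ?T) \<le> ennreal ?p * emeasure lborel ?T"
    proof (rule emeasure_image_le_if_slopes_le[OF g_mono g_lip T gT])
      fix x d :: real assume x: "x \<in> ?T" "0 < d"
      then obtain t where t: "0 < \<bar>t\<bar>" "\<bar>t\<bar> < d" "(g (x + t) - g x) / t < ?p"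
        using slopes_at[of x d] by blast
      show "\<exists>y z. y < z \<and> z - y < d \<and> x \<in> {y..z} \<and> g z - g y \<le> ?p * (z - y)"
      proof (cases "0 < t")
        case True
        then show ?thesis using t by (intro exI[of _ x] exI[of _ "x + t"]) (auto simp: field_simps)
      next
        case False
        then have "t < 0" using t by simp
        then show ?thesis using t by (intro exI[of _ "x + t"] exI[of _ x]) (auto simp: field_simps)
      qed
    qed (use \<open>0 < ?p\<close> in simp)
    have kgT: "k ` g ` ?T = ?T" by (simp add: image_image)
    have "emeasure lborel (k ` g ` ?T) \<le> ennreal (1 / ?q) * emeasure lborel (g ` ?T)"
    proof (rule emeasure_image_le_if_slopes_le[OF k_mono k_lip gT])
      fix y d :: real assume y: "y \<in> g ` ?T" "0 < d"
      then obtain x where x: "x \<in> ?T" "y = g x" by blast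
      define d' where "d' = d / (2 * L + 1)"
      have d': "0 < d'" "(2 * L + 1) * d' = d" using \<open>0 < d\<close> \<open>0 \<le> L\<close> by (auto simp: d'_def)
      obtain t where t: "0 < \<bar>t\<bar>" "\<bar>t\<bar> < d'" "?q < (g (x + t) - g x) / t"
        using slopes_at[of x d'] x d' by blast
      have "(2 * L + 1) * \<bar>t\<bar> < d"
        using t(2) d'(2) \<open>0 \<le> L\<close> by (metis add_pos_nonneg mult_strict_left_mono add.commute
          mult_nonneg_nonneg zero_le_numeral zero_less_one)
      then show "\<exists>a b. a < b \<and> b - a < d \<and> y \<in> {a..b} \<and> k b - k a \<le> 1 / ?q * (b - a)"
      proof (cases "0 < t")
        case True
        then show ?thesis using t x \<open>0 < ?q\<close> \<open>(2 * L + 1) * \<bar>t\<bar> < d\<close>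
            g_upper[of x "x + t"] g_lower[of x "x + t"]
          by (intro exI[of _ "g x"] exI[of _ "g (x + t)"]) (auto simp: field_simps)
      next
        case False
        then have "t < 0" using t by simp
        then show ?thesis using t x \<open>0 < ?q\<close> \<open>(2 * L + 1) * \<bar>t\<bar> < d\<close>
            g_upper[of "x + t" x] g_lower[of "x + t" x]
          by (intro exI[of _ "g (x + t)"] exI[of _ "g x"]) (auto simp: field_simps)
      qed
    qed (use gT kgT T \<open>0 < ?q\<close> in auto)
    then have le2: "emeasure lborel ?T \<le> ennreal (1 / ?q) * emeasure lborel (g ` ?T)"
      by (simp only: kgT)
    have "emeasure lborel ?T \<le> emeasure lborel {- real n .. real n}"
      by (intro emeasure_mono) auto
    then have "emeasure lborel ?T < \<infinity>"
      by (simp add: order_le_less_trans[OF _ ennreal_less_top])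
    then obtain m where m: "emeasure lborel ?T = ennreal m" "0 \<le> m"
      by (cases "emeasure lborel ?T") auto
    have "emeasure lborel ?T \<le> ennreal (1 / ?q) * (ennreal ?p * emeasure lborel ?T)"
      using le2 le1 by (meson mult_left_mono order_trans zero_le)
    then have "ennreal m \<le> ennreal (1 / ?q * (?p * m))"
      using m \<open>0 < ?p\<close> \<open>0 < ?q\<close> by (simp add: ennreal_mult[symmetric])
    then have "m \<le> 1 / ?q * (?p * m)"
      using \<open>0 \<le> m\<close> \<open>0 < ?p\<close> \<open>0 < ?q\<close> by (simp add: ennreal_le_iff)
    then have "?q * m \<le> ?p * m" using \<open>0 < ?q\<close> by (simp add: field_simps)
    then have "m = 0" using \<open>p < q\<close> \<open>0 \<le> m\<close>
      by (metis add.commute add_le_cancel_left linorder_not_le mult_le_cancel_right order_antisym_conv)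
    then show ?thesis using m by simp
  qed auto
  have "?E = (\<Union>n. ?E \<inter> {- real n .. real n})"
  proof safe
    fix x assume "x \<in> ?E"
    obtain n where "\<bar>x\<bar> \<le> real n" using real_arch_simple by blast
    with \<open>x \<in> ?E\<close> have "x \<in> ?E \<inter> {- real n .. real n}" by (simp add: abs_le_iff)
    then show "x \<in> (\<Union>n. ?E \<inter> {- real n .. real n})" by blast
  qed
  moreover have "emeasure lborel (\<Union>n. ?E \<inter> {- real n .. real n}) = 0"
    using bounded_part E by (intro emeasure_UN_eq_0) auto
  ultimately show ?thesis by simp
qed

section \<open>Rademacher's theorem\<close>

text \<open>
  Fubini's theorem for lines of an arbitrary direction, without a change of coordinates: by translation
  invariance the measure of \<open>N\<close> is the average over \<open>t \<in> [0,1]\<close> of that of \<open>N - t e\<close>, and after exchanging the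
  integrals one measures the null sets \<open>{t. x + t e \<in> N}\<close>.
\<close>

lemma emeasure_zero_if_null_on_lines:
  fixes N :: "'a::euclidean_space set" and e :: 'a
  assumes [measurable]: "N \<in> sets borel"
    and null: "\<And>x. emeasure lborel {t::real. x + t *\<^sub>R e \<in> N} = 0"
  shows "emeasure lborel N = 0"
proof -
  have shift: "(\<integral>\<^sup>+x. indicator N (x + t *\<^sub>R e) \<partial>lborel) = emeasure lborel N" for t
  proof -
    have "emeasure lborel N = (\<integral>\<^sup>+x. indicator N x \<partial>distr lborel borel ((+) (t *\<^sub>R e)))"
      by (simp only: lborel_distr_plus) simp
    also have "\<dots> = (\<integral>\<^sup>+x. indicator N (t *\<^sub>R e + x) \<partial>lborel)"
      by (subst nn_integral_distr) auto
    finally show ?thesis by (simp add: add.commute)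
  qed
  have "emeasure lborel N = (\<integral>\<^sup>+t\<in>{0..1::real}. emeasure lborel N \<partial>lborel)"
    by (simp add: nn_integral_cmult_indicator)
  also have "\<dots> = (\<integral>\<^sup>+t. (\<integral>\<^sup>+x. indicator N (x + t *\<^sub>R e) * indicator {0..1} t \<partial>lborel) \<partial>lborel)"
    by (intro nn_integral_cong) (simp add: nn_integral_multc shift)
  also have "\<dots> = (\<integral>\<^sup>+x. (\<integral>\<^sup>+t. indicator N (x + t *\<^sub>R e) * indicator {0..1} t \<partial>lborel) \<partial>lborel)"
    by (rule lborel_pair.Fubini') measurable
  also have "\<dots> = (\<integral>\<^sup>+(x::'a). 0 \<partial>lborel)"
  proof (rule nn_integral_cong)
    fix x :: 'a
    have [measurable]: "{t::real. x + t *\<^sub>R e \<in> N} \<in> sets borel" by measurable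
    have "(\<integral>\<^sup>+t. indicator N (x + t *\<^sub>R e) * indicator {0..1} t \<partial>lborel)
        \<le> (\<integral>\<^sup>+t. indicator {t. x + t *\<^sub>R e \<in> N} t \<partial>lborel)"
      by (intro nn_integral_mono) (auto simp: indicator_def)
    also have "\<dots> = 0" using null[of x] by simp
    finally show "(\<integral>\<^sup>+t. indicator N (x + t *\<^sub>R e) * indicator {0..1} t \<partial>lborel) = 0" by simp
  qed
  finally show ?thesis by simp
qed

definition has_dir_deriv :: "('a::real_normed_vector \<Rightarrow> real) \<Rightarrow> 'a \<Rightarrow> 'a \<Rightarrow> real \<Rightarrow> bool" where
  "has_dir_deriv v e x d \<longleftrightarrow> ((\<lambda>t. (v (x + t *\<^sub>R e) - v x) / t) \<longlongrightarrow> d) (at 0)"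

lemma has_dir_deriv_bound_iff:
  "has_dir_deriv v e x d \<longleftrightarrow>
     (\<forall>\<epsilon>>0. \<exists>\<delta>>0. \<forall>t. \<bar>t\<bar> < \<delta> \<longrightarrow> \<bar>v (x + t *\<^sub>R e) - v x - d * t\<bar> \<le> \<epsilon> * \<bar>t\<bar>)"
proof -
  have quot: "\<bar>(v (x + t *\<^sub>R e) - v x) / t - d\<bar> = \<bar>v (x + t *\<^sub>R e) - v x - d * t\<bar> / \<bar>t\<bar>" if "t \<noteq> 0" for t
    using that by (simp add: abs_divide[symmetric] diff_divide_distrib)
  show ?thesis
  proof
    assume D: "has_dir_deriv v e x d"
    show "\<forall>\<epsilon>>0. \<exists>\<delta>>0. \<forall>t. \<bar>t\<bar> < \<delta> \<longrightarrow> \<bar>v (x + t *\<^sub>R e) - v x - d * t\<bar> \<le> \<epsilon> * \<bar>t\<bar>"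
    proof (intro allI impI)
      fix \<epsilon> :: real assume "0 < \<epsilon>"
      with D obtain \<delta> where \<delta>: "\<delta> > 0"
        "\<And>t. t \<noteq> 0 \<Longrightarrow> \<bar>t\<bar> < \<delta> \<Longrightarrow> \<bar>(v (x + t *\<^sub>R e) - v x) / t - d\<bar> < \<epsilon>"
        unfolding has_dir_deriv_def tendsto_iff eventually_at dist_real_def by auto
      have "\<bar>v (x + t *\<^sub>R e) - v x - d * t\<bar> \<le> \<epsilon> * \<bar>t\<bar>" if "\<bar>t\<bar> < \<delta>" for t
        using \<delta>(2)[of t] that quot[of t] by (cases "t = 0") (auto simp: divide_less_eq)
      then show "\<exists>\<delta>>0. \<forall>t. \<bar>t\<bar> < \<delta> \<longrightarrow> \<bar>v (x + t *\<^sub>R e) - v x - d * t\<bar> \<le> \<epsilon> * \<bar>t\<bar>"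
        using \<delta>(1) by blast
    qed
  next
    assume R: "\<forall>\<epsilon>>0. \<exists>\<delta>>0. \<forall>t. \<bar>t\<bar> < \<delta> \<longrightarrow> \<bar>v (x + t *\<^sub>R e) - v x - d * t\<bar> \<le> \<epsilon> * \<bar>t\<bar>"
    show "has_dir_deriv v e x d"
      unfolding has_dir_deriv_def tendsto_iff eventually_at dist_real_def
    proof (intro allI impI)
      fix \<epsilon> :: real assume "0 < \<epsilon>"
      then obtain \<delta> where \<delta>: "\<delta> > 0"
        "\<And>t. \<bar>t\<bar> < \<delta> \<Longrightarrow> \<bar>v (x + t *\<^sub>R e) - v x - d * t\<bar> \<le> \<epsilon> / 2 * \<bar>t\<bar>"
        using R[rule_format, of "\<epsilon> / 2"] by auto
      have "\<bar>(v (x + t *\<^sub>R e) - v x) / t - d\<bar> < \<epsilon>" if "t \<noteq> 0" "\<bar>t\<bar> < \<delta>" for t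
      proof -
        have "\<bar>v (x + t *\<^sub>R e) - v x - d * t\<bar> / \<bar>t\<bar> \<le> \<epsilon> / 2"
          using \<delta>(2)[of t] that by (simp add: divide_le_eq)
        then show ?thesis using quot[of t] that \<open>0 < \<epsilon>\<close> by linarith
      qed
      then show "\<exists>\<delta>>0. \<forall>t\<in>UNIV. t \<noteq> 0 \<and> \<bar>t - 0\<bar> < \<delta> \<longrightarrow>
          \<bar>(v (x + t *\<^sub>R e) - v x) / t - d\<bar> < \<epsilon>"
        using \<delta>(1) by auto
    qed
  qed
qed

text \<open>
  The difference quotients are bounded, so if their lower and upper limits agree the limit is finite;
  otherwise two rationals fit strictly between them.
\<close>

lemma has_dir_deriv_or_oscillating:
  assumes lip: "L-lipschitz_on UNIV v"
  shows "(\<exists>d. has_dir_deriv v e x d) \<or>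
    (\<exists>p q::rat. p < q \<and> x \<in> oscillating_slopes v e (of_rat p) (of_rat q))"
proof -
  let ?s = "\<lambda>t. (v (x + t *\<^sub>R e) - v x) / t"
  let ?F = "at (0::real)"
  define M where "M = L * norm e"
  have bound: "\<bar>?s t\<bar> \<le> M" if "t \<noteq> 0" for t
    using lipschitz_on_normD[OF lip, of "x + t *\<^sub>R e" x] that by (simp add: M_def field_simps)
  have ev: "eventually (\<lambda>t. \<bar>?s t\<bar> \<le> M) ?F"
    using bound by (auto simp: eventually_at intro!: exI[of _ 1])
  define Li where "Li = Liminf ?F (\<lambda>t. ereal (?s t))"
  define Ls where "Ls = Limsup ?F (\<lambda>t. ereal (?s t))"
  have "ereal (- M) \<le> Li" unfolding Li_def
    by (rule Liminf_bounded) (use ev in \<open>auto elim!: eventually_mono simp del: abs_divide simp: abs_le_iff\<close>)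
  have "Ls \<le> ereal M" unfolding Ls_def
    by (rule Limsup_bounded) (use ev in \<open>auto elim!: eventually_mono simp del: abs_divide simp: abs_le_iff\<close>)
  have "Li \<le> Ls" unfolding Li_def Ls_def by (rule Liminf_le_Limsup) simp
  show ?thesis
  proof (cases "Li = Ls")
    case True
    obtain d where d: "Ls = ereal d"
      using \<open>ereal (- M) \<le> Li\<close> \<open>Ls \<le> ereal M\<close> True by (cases Ls) auto
    have "((\<lambda>t. ereal (?s t)) \<longlongrightarrow> ereal d) ?F"
      by (rule Liminf_eq_Limsup) (use d True Li_def Ls_def in auto)
    then show ?thesis by (auto simp: has_dir_deriv_def)
  next
    case False
    then have "Li < Ls" using \<open>Li \<le> Ls\<close> by simp
    then obtain q :: rat where q: "Li < ereal (of_rat q)" "ereal (of_rat q) < Ls"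
      using ereal_dense3 by blast
    obtain p :: rat where p: "Li < ereal (of_rat p)" "ereal (of_rat p) < ereal (of_rat q)"
      using ereal_dense3[OF q(1)] by blast
    have "\<exists>t. 0 < \<bar>t\<bar> \<and> \<bar>t\<bar> < \<delta> \<and> ?s t < of_rat p" if "0 < \<delta>" for \<delta>
    proof (rule ccontr)
      assume "\<not> ?thesis"
      then have "eventually (\<lambda>t. ereal (of_rat p) \<le> ereal (?s t)) ?F"
        using that by (auto simp: eventually_at not_less intro!: exI[of _ \<delta>])
      then have "ereal (of_rat p) \<le> Li" unfolding Li_def by (rule Liminf_bounded)
      then show False using p by simp
    qed
    moreover have "\<exists>t. 0 < \<bar>t\<bar> \<and> \<bar>t\<bar> < \<delta> \<and> of_rat q < ?s t" if "0 < \<delta>" for \<delta>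
    proof (rule ccontr)
      assume "\<not> ?thesis"
      then have "eventually (\<lambda>t. ereal (?s t) \<le> ereal (of_rat q)) ?F"
        using that by (auto simp: eventually_at not_less intro!: exI[of _ \<delta>])
      then have "Ls \<le> ereal (of_rat q)" unfolding Ls_def by (rule Limsup_bounded)
      then show False using q by simp
    qed
    ultimately have "x \<in> oscillating_slopes v e (of_rat p) (of_rat q)"
      by (simp add: oscillating_slopes_def)
    moreover have "p < q" using p(2) by (simp add: of_rat_less)
    ultimately show ?thesis by blast
  qed
qed

lemma AE_dir_deriv_exists:
  fixes v :: "'a::euclidean_space \<Rightarrow> real"
  assumes lip: "L-lipschitz_on UNIV v"
  shows "AE x in lborel. \<exists>d. has_dir_deriv v e x d"
proof -
  have borel: "oscillating_slopes v e p q \<in> sets borel" for p q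
    by (rule oscillating_slopes_borel) (rule lipschitz_on_continuous_on[OF lip])
  have "emeasure lborel (oscillating_slopes v e p q) = 0" if "p < q" for p q
  proof (rule emeasure_zero_if_null_on_lines[OF borel])
    fix x :: 'a
    have "(L * norm e)-lipschitz_on UNIV (\<lambda>t. v (x + t *\<^sub>R e))"
    proof (rule lipschitz_onI)
      show "dist (v (x + s *\<^sub>R e)) (v (x + t *\<^sub>R e)) \<le> L * norm e * dist s t" for s t
        using lipschitz_onD[OF lip, of "x + s *\<^sub>R e" "x + t *\<^sub>R e"]
        by (simp add: dist_norm scaleR_diff_left[symmetric] mult_ac)
      show "0 \<le> L * norm e" using lipschitz_on_nonneg[OF lip] by simp
    qed
    from oscillating_slopes_null_real[OF this that]
    show "emeasure lborel {t. x + t *\<^sub>R e \<in> oscillating_slopes v e p q} = 0"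
      by (simp add: oscillating_slopes_def algebra_simps)
  qed
  then have "AE x in lborel. x \<notin> oscillating_slopes v e p q" if "p < q" for p q
    using that borel[of p q] by (intro AE_not_in) (auto simp: null_sets_def)
  then have "AE x in lborel. \<forall>pq\<in>{(p, q). p < q}.
      x \<notin> oscillating_slopes v e (of_rat (fst pq)) (of_rat (snd pq))"
    by (intro AE_ball_countable') (auto simp: of_rat_less)
  then show ?thesis
  proof eventually_elim
    case (elim x)
    then show ?case using has_dir_deriv_or_oscillating[OF lip, of e x] by auto
  qed
qed


lemma separated_set_null:
  fixes A :: "real set"
  assumes "0 < d" and sep: "\<And>s t. s \<in> A \<Longrightarrow> t \<in> A \<Longrightarrow> \<bar>s - t\<bar> < d \<Longrightarrow> s = t"
  shows "emeasure lborel A = 0"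
proof -
  have "inj_on (\<lambda>t. \<lfloor>t / d\<rfloor>) A"
  proof (rule inj_onI)
    fix s t assume st: "s \<in> A" "t \<in> A" "\<lfloor>s / d\<rfloor> = \<lfloor>t / d\<rfloor>"
    have "\<bar>s / d - t / d\<bar> < 1" using st(3) by linarith
    then have "\<bar>s - t\<bar> < d"
      using \<open>0 < d\<close> by (simp add: diff_divide_distrib[symmetric] abs_divide)
    then show "s = t" using sep st by blast
  qed
  then have "countable A"
    by (rule countable_image_inj_on[rotated]) auto
  then show ?thesis by (rule emeasure_lborel_countable)
qed

text \<open>
  If all three derivatives exist at \<open>x\<close> and additivity fails, then \<open>x\<close> lies in one of countably many closed sets \<open>A r s \<epsilon> k\<close>, where
  the derivatives along \<open>a\<close> and \<open>b\<close> are \<open>r\<close> and \<open>s\<close> up to \<open>\<epsilon>\<close>, uniformly at scales below \<open>1 / Suc k\<close>, while the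
  derivative along \<open>a + b\<close> misses \<open>r + s\<close> by \<open>3\<epsilon>\<close>. Two points \<open>y\<close> and \<open>y + t a\<close> with small \<open>t\<close> cannot both lie in it:
  going from \<open>y\<close> along \<open>t a\<close> and then along \<open>t b\<close> produces an error of at most \<open>2\<epsilon>|t|\<close>. So lines of
  direction \<open>a\<close> meet the set in separated points only.
\<close>

lemma AE_dir_deriv_add:
  fixes v :: "'a::euclidean_space \<Rightarrow> real"
  assumes lip: "L-lipschitz_on UNIV v"
  shows "AE x in lborel. \<forall>r s. has_dir_deriv v a x r \<longrightarrow> has_dir_deriv v b x s \<longrightarrow>
           has_dir_deriv v (a + b) x (r + s)"
proof -
  have v_cont: "continuous_on UNIV v" by (rule lipschitz_on_continuous_on[OF lip])
  define A where "A r s \<epsilon> k = {x. \<forall>t. 0 < \<bar>t\<bar> \<and> \<bar>t\<bar> < 1 / Suc k \<longrightarrow>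
      \<bar>v (x + t *\<^sub>R a) - v x - r * t\<bar> \<le> \<epsilon> * \<bar>t\<bar> \<and> \<bar>v (x + t *\<^sub>R b) - v x - s * t\<bar> \<le> \<epsilon> * \<bar>t\<bar> \<and>
      3 * \<epsilon> * \<bar>t\<bar> \<le> \<bar>v (x + t *\<^sub>R (a + b)) - v x - (r + s) * t\<bar>}" for r s \<epsilon> and k :: nat
  have closed: "closed (A r s \<epsilon> k)" for r s \<epsilon> k
  proof -
    have "A r s \<epsilon> k = (\<Inter>t\<in>{t. 0 < \<bar>t\<bar> \<and> \<bar>t\<bar> < 1 / Suc k}.
        {x. \<bar>v (x + t *\<^sub>R a) - v x - r * t\<bar> \<le> \<epsilon> * \<bar>t\<bar>} \<inter>
        {x. \<bar>v (x + t *\<^sub>R b) - v x - s * t\<bar> \<le> \<epsilon> * \<bar>t\<bar>} \<inter>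
        {x. 3 * \<epsilon> * \<bar>t\<bar> \<le> \<bar>v (x + t *\<^sub>R (a + b)) - v x - (r + s) * t\<bar>})"
      by (auto simp: A_def)
    then show ?thesis
      by (simp only:) (intro closed_INT closed_Int closed_Collect_le ballI continuous_intros
          continuous_on_compose2[OF v_cont] subset_UNIV)
  qed
  have "emeasure lborel (A r s \<epsilon> k) = 0" if "0 < \<epsilon>" for r s \<epsilon> k
  proof (rule emeasure_zero_if_null_on_lines[where e = a])
    show "A r s \<epsilon> k \<in> sets borel" using closed by (rule borel_closed)
    fix x
    have "y + t *\<^sub>R a \<notin> A r s \<epsilon> k" if y: "y \<in> A r s \<epsilon> k" and t: "0 < \<bar>t\<bar>" "\<bar>t\<bar> < 1 / Suc k" for y t
    proof
      assume z: "y + t *\<^sub>R a \<in> A r s \<epsilon> k"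
      have "\<bar>v (y + t *\<^sub>R a) - v y - r * t\<bar> \<le> \<epsilon> * \<bar>t\<bar>"
        "3 * \<epsilon> * \<bar>t\<bar> \<le> \<bar>v (y + t *\<^sub>R (a + b)) - v y - (r + s) * t\<bar>"
        using y t by (auto simp: A_def)
      moreover have "\<bar>v (y + t *\<^sub>R a + t *\<^sub>R b) - v (y + t *\<^sub>R a) - s * t\<bar> \<le> \<epsilon> * \<bar>t\<bar>"
        using z t by (auto simp: A_def)
      moreover have "y + t *\<^sub>R (a + b) = y + t *\<^sub>R a + t *\<^sub>R b" by (simp add: algebra_simps)
      moreover have "0 < \<epsilon> * \<bar>t\<bar>" using \<open>0 < \<epsilon>\<close> t by simp
      ultimately show False by (simp add: algebra_simps)
    qed
    note step = this
    show "emeasure lborel {t. x + t *\<^sub>R a \<in> A r s \<epsilon> k} = 0"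
    proof (rule separated_set_null[of "1 / Suc k"])
      fix t u assume tu: "t \<in> {t. x + t *\<^sub>R a \<in> A r s \<epsilon> k}" "u \<in> {t. x + t *\<^sub>R a \<in> A r s \<epsilon> k}"
        "\<bar>t - u\<bar> < 1 / Suc k"
      show "t = u"
      proof (rule ccontr)
        assume "t \<noteq> u"
        then have "x + u *\<^sub>R a + (t - u) *\<^sub>R a \<notin> A r s \<epsilon> k" using tu by (intro step) auto
        moreover have "x + u *\<^sub>R a + (t - u) *\<^sub>R a = x + t *\<^sub>R a" by (simp add: algebra_simps)
        ultimately show False using tu by simp
      qed
    qed simp
  qed
  then have "AE x in lborel. x \<notin> A r s \<epsilon> k" if "0 < \<epsilon>" for r s \<epsilon> k
    using that closed[of r s \<epsilon> k] by (intro AE_not_in) (auto simp: null_sets_def borel_closed)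
  then have "AE x in lborel. \<forall>(r, s, \<epsilon>, k) \<in> UNIV \<times> UNIV \<times> {0<..} \<times> UNIV.
      x \<notin> A (of_rat r) (of_rat s) (of_rat \<epsilon>) k"
    by (intro AE_ball_countable') (auto simp: zero_less_of_rat_iff)
  moreover have "AE x in lborel. \<exists>d. has_dir_deriv v (a + b) x d"
    by (rule AE_dir_deriv_exists[OF lip])
  ultimately show ?thesis
  proof eventually_elim
    case (elim x)
    then obtain w where w: "has_dir_deriv v (a + b) x w" by blast
    show ?case
    proof (intro allI impI)
      fix r s assume rs: "has_dir_deriv v a x r" "has_dir_deriv v b x s"
      have "w = r + s"
      proof (rule ccontr)
        assume "w \<noteq> r + s"
        \<comment> \<open>The rational approximations cost \<open>\<epsilon>/2\<close> each, which leaves more than \<open>3\<epsilon>\<close> of the gap \<open>\<eta> > 6\<epsilon>\<close>.\<close>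
        define \<eta> where "\<eta> = \<bar>w - (r + s)\<bar>"
        have "0 < \<eta>" using \<open>w \<noteq> r + s\<close> by (simp add: \<eta>_def)
        obtain \<epsilon> :: rat where \<epsilon>: "0 < real_of_rat \<epsilon>" "of_rat \<epsilon> < \<eta> / 6"
          using of_rat_dense[of 0 "\<eta> / 6"] \<open>0 < \<eta>\<close> by auto
        define \<delta> where "\<delta> = real_of_rat \<epsilon> / 2"
        have "0 < \<delta>" using \<epsilon> by (simp add: \<delta>_def)
        obtain r' :: rat where r': "r - \<delta> < of_rat r'" "of_rat r' < r + \<delta>"
          using of_rat_dense[of "r - \<delta>" "r + \<delta>"] \<open>0 < \<delta>\<close> by auto
        obtain s' :: rat where s': "s - \<delta> < of_rat s'" "of_rat s' < s + \<delta>"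
          using of_rat_dense[of "s - \<delta>" "s + \<delta>"] \<open>0 < \<delta>\<close> by auto
        obtain \<delta>1 where \<delta>1: "\<delta>1 > 0" "\<And>t. \<bar>t\<bar> < \<delta>1 \<Longrightarrow> \<bar>v (x + t *\<^sub>R a) - v x - r * t\<bar> \<le> \<delta> * \<bar>t\<bar>"
          using rs(1) \<open>0 < \<delta>\<close> unfolding has_dir_deriv_bound_iff by blast
        obtain \<delta>2 where \<delta>2: "\<delta>2 > 0" "\<And>t. \<bar>t\<bar> < \<delta>2 \<Longrightarrow> \<bar>v (x + t *\<^sub>R b) - v x - s * t\<bar> \<le> \<delta> * \<bar>t\<bar>"
          using rs(2) \<open>0 < \<delta>\<close> unfolding has_dir_deriv_bound_iff by blast
        obtain \<delta>3 where \<delta>3: "\<delta>3 > 0"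
          "\<And>t. \<bar>t\<bar> < \<delta>3 \<Longrightarrow> \<bar>v (x + t *\<^sub>R (a + b)) - v x - w * t\<bar> \<le> \<delta> * \<bar>t\<bar>"
          using w \<open>0 < \<delta>\<close> unfolding has_dir_deriv_bound_iff by blast
        obtain k :: nat where k: "1 / Suc k < min \<delta>1 (min \<delta>2 \<delta>3)"
          using nat_approx_posE[of "min \<delta>1 (min \<delta>2 \<delta>3)"] \<delta>1(1) \<delta>2(1) \<delta>3(1) by auto
        have "x \<in> A (of_rat r') (of_rat s') (of_rat \<epsilon>) k"
          unfolding A_def mem_Collect_eq
        proof (intro allI impI)
          fix t :: real assume t: "0 < \<bar>t\<bar> \<and> \<bar>t\<bar> < 1 / Suc k"
          then have t123: "\<bar>t\<bar> < \<delta>1" "\<bar>t\<bar> < \<delta>2" "\<bar>t\<bar> < \<delta>3" using k by auto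
          have close: "\<bar>(c - c') * t\<bar> \<le> \<delta> * \<bar>t\<bar>" if "c - \<delta> < c'" "c' < c + \<delta>" for c c' :: real
            using that unfolding abs_mult by (intro mult_right_mono) auto
          have e: "\<delta> * \<bar>t\<bar> + \<delta> * \<bar>t\<bar> = of_rat \<epsilon> * \<bar>t\<bar>" by (simp add: \<delta>_def algebra_simps)
          have big: "6 * (of_rat \<epsilon> * \<bar>t\<bar>) \<le> \<bar>(w - (r + s)) * t\<bar>"
            using \<epsilon>(2) unfolding abs_mult \<eta>_def[symmetric]
            by (simp add: mult.assoc[symmetric] mult_right_mono)
          have "0 \<le> real_of_rat \<epsilon> * \<bar>t\<bar>" using \<epsilon>(1) by simp
          have near: "\<bar>V - c' * t\<bar> \<le> of_rat \<epsilon> * \<bar>t\<bar>"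
            if "\<bar>V - c * t\<bar> \<le> \<delta> * \<bar>t\<bar>" "\<bar>(c - c') * t\<bar> \<le> \<delta> * \<bar>t\<bar>" for V c c'
          proof -
            have "V - c' * t = (V - c * t) + (c - c') * t" by (simp add: algebra_simps)
            then have "\<bar>V - c' * t\<bar> \<le> \<bar>V - c * t\<bar> + \<bar>(c - c') * t\<bar>" by (simp only: abs_triangle_ineq)
            then show ?thesis using that e by linarith
          qed
          have far: "\<bar>(w - (r + s)) * t\<bar> \<le> \<bar>V - (r' + s') * t\<bar> + \<bar>V - w * t\<bar> + \<bar>(r - r') * t\<bar> + \<bar>(s - s') * t\<bar>"
            for V r' s' :: real
          proof -
            have "(w - (r + s)) * t = (V - (r' + s') * t) - (V - w * t) - (r - r') * t - (s - s') * t"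
              by (simp add: algebra_simps)
            then show ?thesis by linarith
          qed
          from far[of "v (x + t *\<^sub>R (a + b)) - v x" "of_rat r'" "of_rat s'"]
          have "3 * of_rat \<epsilon> * \<bar>t\<bar> \<le> \<bar>v (x + t *\<^sub>R (a + b)) - v x - (of_rat r' + of_rat s') * t\<bar>"
            using \<delta>3(2)[OF t123(3)] close[OF r'] close[OF s'] e big
              \<open>0 \<le> real_of_rat \<epsilon> * \<bar>t\<bar>\<close> by (simp only: mult.assoc)
          then show "\<bar>v (x + t *\<^sub>R a) - v x - of_rat r' * t\<bar> \<le> of_rat \<epsilon> * \<bar>t\<bar> \<and>
              \<bar>v (x + t *\<^sub>R b) - v x - of_rat s' * t\<bar> \<le> of_rat \<epsilon> * \<bar>t\<bar> \<and>
              3 * of_rat \<epsilon> * \<bar>t\<bar> \<le> \<bar>v (x + t *\<^sub>R (a + b)) - v x - (of_rat r' + of_rat s') * t\<bar>"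
            using near[OF \<delta>1(2)[OF t123(1)] close[OF r']] near[OF \<delta>2(2)[OF t123(2)] close[OF s']]
            by blast
        qed
        then show False using elim(1) \<epsilon>(1) by (auto simp: zero_less_of_rat_iff)
      qed
      then show "has_dir_deriv v (a + b) x (r + s)" using w by simp
    qed
  qed
qed

lemma has_dir_deriv_scaleR:
  assumes "has_dir_deriv v e x d"
  shows "has_dir_deriv v (c *\<^sub>R e) x (c * d)"
  unfolding has_dir_deriv_bound_iff
proof (intro allI impI)
  fix \<epsilon> :: real assume "0 < \<epsilon>"
  then obtain \<delta> where \<delta>: "\<delta> > 0"
    "\<And>t. \<bar>t\<bar> < \<delta> \<Longrightarrow> \<bar>v (x + t *\<^sub>R e) - v x - d * t\<bar> \<le> \<epsilon> / (\<bar>c\<bar> + 1) * \<bar>t\<bar>"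
    using assms[unfolded has_dir_deriv_bound_iff, rule_format, of "\<epsilon> / (\<bar>c\<bar> + 1)"] by auto
  have "\<bar>v (x + t *\<^sub>R c *\<^sub>R e) - v x - c * d * t\<bar> \<le> \<epsilon> * \<bar>t\<bar>" if t: "\<bar>t\<bar> < \<delta> / (\<bar>c\<bar> + 1)" for t
  proof -
    have "\<bar>t\<bar> * \<bar>c\<bar> \<le> \<bar>t\<bar> * (\<bar>c\<bar> + 1)" by (intro mult_left_mono) auto
    also have "\<dots> < \<delta>" using t by (simp add: pos_less_divide_eq)
    finally have "\<bar>t * c\<bar> < \<delta>" by (simp add: abs_mult)
    then have "\<bar>v (x + (t * c) *\<^sub>R e) - v x - d * (t * c)\<bar> \<le> \<epsilon> / (\<bar>c\<bar> + 1) * \<bar>t * c\<bar>" by (rule \<delta>(2))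
    also have "\<dots> = \<epsilon> * \<bar>t\<bar> * (\<bar>c\<bar> / (\<bar>c\<bar> + 1))" by (simp add: abs_mult)
    also have "\<dots> \<le> \<epsilon> * \<bar>t\<bar> * 1" using \<open>0 < \<epsilon>\<close> by (intro mult_left_mono) auto
    finally show ?thesis by (simp add: mult_ac)
  qed
  then show "\<exists>\<delta>>0. \<forall>t. \<bar>t\<bar> < \<delta> \<longrightarrow> \<bar>v (x + t *\<^sub>R c *\<^sub>R e) - v x - c * d * t\<bar> \<le> \<epsilon> * \<bar>t\<bar>"
    using \<delta>(1) by (intro exI[of _ "\<delta> / (\<bar>c\<bar> + 1)"]) auto
qed

lemma AE_dir_deriv_linear:
  fixes v :: "'a::euclidean_space \<Rightarrow> real"
  assumes lip: "L-lipschitz_on UNIV v"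
  shows "AE x in lborel. \<forall>d. (\<forall>i\<in>Basis. has_dir_deriv v i x (d i)) \<longrightarrow>
           has_dir_deriv v e x (\<Sum>i\<in>Basis. (e \<bullet> i) * d i)"
proof -
  have "AE x in lborel. \<forall>d. (\<forall>i\<in>Basis. has_dir_deriv v i x (d i)) \<longrightarrow>
           has_dir_deriv v (\<Sum>i\<in>S. (e \<bullet> i) *\<^sub>R i) x (\<Sum>i\<in>S. (e \<bullet> i) * d i)"
    if "S \<subseteq> Basis" for S :: "'a set"
    using finite_subset[OF that finite_Basis] that
  proof (induction S rule: finite_induct)
    case empty
    then show ?case by (simp add: has_dir_deriv_def)
  next
    case (insert j S)
    then have "AE x in lborel. \<forall>d. (\<forall>i\<in>Basis. has_dir_deriv v i x (d i)) \<longrightarrow>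
           has_dir_deriv v (\<Sum>i\<in>S. (e \<bullet> i) *\<^sub>R i) x (\<Sum>i\<in>S. (e \<bullet> i) * d i)" by simp
    moreover note AE_dir_deriv_add[OF lip, of "(e \<bullet> j) *\<^sub>R j" "\<Sum>i\<in>S. (e \<bullet> i) *\<^sub>R i"]
    ultimately show ?case
    proof eventually_elim
      case (elim x)
      show ?case
      proof (intro allI impI)
        fix d assume d: "\<forall>i\<in>Basis. has_dir_deriv v i x (d i)"
        then have "has_dir_deriv v ((e \<bullet> j) *\<^sub>R j) x ((e \<bullet> j) * d j)"
          using insert.prems by (auto intro: has_dir_deriv_scaleR)
        then have "has_dir_deriv v ((e \<bullet> j) *\<^sub>R j + (\<Sum>i\<in>S. (e \<bullet> i) *\<^sub>R i)) x
            ((e \<bullet> j) * d j + (\<Sum>i\<in>S. (e \<bullet> i) * d i))"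
          using elim d by blast
        then show "has_dir_deriv v (\<Sum>i\<in>insert j S. (e \<bullet> i) *\<^sub>R i) x (\<Sum>i\<in>insert j S. (e \<bullet> i) * d i)"
          using insert.hyps by simp
      qed
    qed
  qed
  from this[of Basis] show ?thesis by (simp add: euclidean_representation)
qed

text \<open>
  Rademacher's theorem. Almost everywhere the directional derivatives along a countable dense set of
  directions exist and are given by one vector \<open>G\<close>. The Lipschitz bound carries the first-order
  expansion from finitely many directions, an \<open>\<eta>\<close>-net of the unit ball, to all directions uniformly.
\<close>

theorem AE_differentiable_if_lipschitz:
  fixes v :: "'a::euclidean_space \<Rightarrow> real"
  assumes lip: "L-lipschitz_on UNIV v"
  shows "AE x in lborel. v differentiable (at x)"
proof -
  obtain D :: "'a set" where D: "countable D" "\<And>X. open X \<Longrightarrow> X \<noteq> {} \<Longrightarrow> \<exists>d\<in>D. d \<in> X"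
    using countable_dense_setE by blast
  have "0 \<le> L" using lip by (rule lipschitz_on_nonneg)
  have "AE x in lborel. \<forall>i\<in>Basis. \<exists>d. has_dir_deriv v i x d"
    by (intro AE_ball_countable' AE_dir_deriv_exists[OF lip]) (simp add: countable_finite)
  moreover have "AE x in lborel. \<forall>e\<in>D. \<forall>d. (\<forall>i\<in>Basis. has_dir_deriv v i x (d i)) \<longrightarrow>
           has_dir_deriv v e x (\<Sum>i\<in>Basis. (e \<bullet> i) * d i)"
    by (intro AE_ball_countable' AE_dir_deriv_linear[OF lip] D)
  ultimately show ?thesis
  proof eventually_elim
    case (elim x)
    from elim(1) obtain d where d: "\<forall>i\<in>Basis. has_dir_deriv v i x (d i)" by metis
    define G where "G = (\<Sum>i\<in>Basis. d i *\<^sub>R i)"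
    have eG: "e \<bullet> G = (\<Sum>i\<in>Basis. (e \<bullet> i) * d i)" for e
      by (simp add: G_def inner_sum_right mult.commute)
    have dirD: "has_dir_deriv v e x (e \<bullet> G)" if "e \<in> D" for e
      using elim(2) that d unfolding eG by blast
    have "(v has_derivative (\<lambda>h. h \<bullet> G)) (at x)"
      unfolding has_derivative_at_alt
    proof (intro conjI allI impI)
      show "bounded_linear (\<lambda>h. h \<bullet> G)" by (rule bounded_linear_inner_left)
      fix \<epsilon> :: real assume "0 < \<epsilon>"
      \<comment> \<open>Replacing a direction by one at distance \<open>\<eta>\<close> changes \<open>v\<close> by \<open>L \<eta>\<close> and the linear part by
        \<open>norm G * \<eta>\<close> per unit of length, together less than \<open>\<epsilon>/2\<close>.\<close>
      define \<eta> where "\<eta> = \<epsilon> / (2 * (L + norm G + 1))"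
      have "0 < L + norm G + 1" using \<open>0 \<le> L\<close> by (smt (verit) norm_ge_zero)
      then have "0 < \<eta>" and \<eta>: "(L + norm G + 1) * \<eta> = \<epsilon> / 2"
        using \<open>0 < \<epsilon>\<close> by (simp_all add: \<eta>_def field_simps)
      have "cball 0 1 \<subseteq> (\<Union>e\<in>D. ball e \<eta>)"
      proof
        fix y :: 'a
        obtain e where "e \<in> D" "e \<in> ball y \<eta>" using D(2)[of "ball y \<eta>"] \<open>0 < \<eta>\<close> by auto
        then show "y \<in> (\<Union>e\<in>D. ball e \<eta>)" by (auto simp: dist_commute)
      qed
      then obtain D' where D': "D' \<subseteq> D" "finite D'" "cball 0 1 \<subseteq> (\<Union>e\<in>D'. ball e \<eta>)"
        by (rule compactE_image[OF compact_cball open_ball])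
      have "\<exists>\<delta>>0. \<forall>t. \<bar>t\<bar> < \<delta> \<longrightarrow> \<bar>v (x + t *\<^sub>R e) - v x - (e \<bullet> G) * t\<bar> \<le> \<epsilon> / 2 * \<bar>t\<bar>" if "e \<in> D'" for e
        using dirD[of e] that D'(1) \<open>0 < \<epsilon>\<close> unfolding has_dir_deriv_bound_iff by (meson half_gt_zero subsetD)
      then obtain \<delta> where \<delta>: "\<And>e. e \<in> D' \<Longrightarrow> \<delta> e > 0"
        "\<And>e t. e \<in> D' \<Longrightarrow> \<bar>t\<bar> < \<delta> e \<Longrightarrow> \<bar>v (x + t *\<^sub>R e) - v x - (e \<bullet> G) * t\<bar> \<le> \<epsilon> / 2 * \<bar>t\<bar>"
        by metis
      have "D' \<noteq> {}" using D'(3) by auto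
      define m where "m = Min (\<delta> ` D')"
      have "0 < m" using D'(2) \<open>D' \<noteq> {}\<close> \<delta>(1) by (simp add: m_def)
      have "\<bar>v y - v x - (y - x) \<bullet> G\<bar> \<le> \<epsilon> * norm (y - x)" if y: "norm (y - x) < m" for y
      proof (cases "y = x")
        case False
        define t where "t = norm (y - x)"
        define h where "h = (y - x) /\<^sub>R t"
        have "0 < t" using False by (simp add: t_def)
        have th: "y - x = t *\<^sub>R h" using \<open>0 < t\<close> by (simp add: h_def)
        have "norm h = 1" using \<open>0 < t\<close> by (simp add: h_def t_def)
        then obtain e where e: "e \<in> D'" "norm (h - e) < \<eta>"
          using D'(3) by (force simp: dist_norm norm_minus_commute)
        have "m \<le> \<delta> e" using D'(2) e by (simp add: m_def)
        then have 1: "\<bar>v (x + t *\<^sub>R e) - v x - (e \<bullet> G) * t\<bar> \<le> \<epsilon> / 2 * t"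
          using \<delta>(2)[OF e(1), of t] y \<open>0 < t\<close> by (simp add: t_def)
        have yh: "y = x + t *\<^sub>R h" using th by (simp add: algebra_simps)
        have "\<bar>v y - v (x + t *\<^sub>R e)\<bar> \<le> L * norm (y - (x + t *\<^sub>R e))"
          using lipschitz_on_normD[OF lip, of y "x + t *\<^sub>R e"] by simp
        also have "norm (y - (x + t *\<^sub>R e)) = t * norm (h - e)"
          using \<open>0 < t\<close> by (simp add: yh scaleR_diff_right[symmetric])
        also have "L * (t * norm (h - e)) \<le> L * (t * \<eta>)"
          using e \<open>0 \<le> L\<close> \<open>0 < t\<close> by (intro mult_left_mono) auto
        finally have 2: "\<bar>v y - v (x + t *\<^sub>R e)\<bar> \<le> L * (t * \<eta>)" .
        have "\<bar>(e - h) \<bullet> G\<bar> \<le> norm (e - h) * norm G" by (rule Cauchy_Schwarz_ineq2)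
        also have "\<dots> \<le> \<eta> * norm G"
          using e by (intro mult_right_mono) (auto simp: norm_minus_commute)
        finally have "t * \<bar>(e - h) \<bullet> G\<bar> \<le> t * (\<eta> * norm G)"
          using \<open>0 < t\<close> by (intro mult_left_mono) auto
        moreover have "t * \<bar>(e - h) \<bullet> G\<bar> = \<bar>(e \<bullet> G) * t - (y - x) \<bullet> G\<bar>"
          using \<open>0 < t\<close> unfolding th by (simp add: abs_mult[symmetric, of t, simplified] algebra_simps abs_mult_pos')
        ultimately have 3: "\<bar>(e \<bullet> G) * t - (y - x) \<bullet> G\<bar> \<le> t * (\<eta> * norm G)" by simp
        have "L * (t * \<eta>) + \<epsilon> / 2 * t + t * (\<eta> * norm G) = t * ((L + norm G + 1) * \<eta>) - t * \<eta> + \<epsilon> / 2 * t"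
          by (simp add: algebra_simps)
        also have "\<dots> \<le> \<epsilon> * t" unfolding \<eta> using \<open>0 < t\<close> \<open>0 < \<eta>\<close> by (simp add: algebra_simps)
        finally have "L * (t * \<eta>) + \<epsilon> / 2 * t + t * (\<eta> * norm G) \<le> \<epsilon> * t" .
        with 1 2 3 show ?thesis unfolding t_def[symmetric] by linarith
      qed auto
      then show "\<exists>d>0. \<forall>y. norm (y - x) < d \<longrightarrow>
          norm (v y - v x - (y - x) \<bullet> G) \<le> \<epsilon> * norm (y - x)"
        using \<open>0 < m\<close> by auto
    qed
    then show ?case by (rule differentiableI)
  qed
qed

section \<open>Lipschitz extension and gradients\<close>

text \<open>
  McShane's extension: the largest function with Lipschitz constant \<open>L\<close> that lies below \<open>u\<close> on \<open>S\<close>.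
\<close>

lemma lipschitz_extension_UNIV:
  fixes u :: "'a::metric_space \<Rightarrow> real"
  assumes lip: "L-lipschitz_on S u"
  obtains U where "L-lipschitz_on UNIV U" "\<And>x. x \<in> S \<Longrightarrow> U x = u x"
proof (cases "S = {}")
  case True
  then show ?thesis using that[of "\<lambda>_. 0"] lipschitz_on_nonneg[OF lip] by (auto simp: lipschitz_on_def)
next
  case False
  then obtain s where s: "s \<in> S" by blast
  have "0 \<le> L" using lip by (rule lipschitz_on_nonneg)
  define U where "U x = (INF y\<in>S. u y + L * dist x y)" for x
  have lower: "u s - L * dist x s \<le> u y + L * dist x y" if "y \<in> S" for x y
  proof -
    have "u s - u y \<le> L * dist s y" using lipschitz_onD[OF lip s that] by (simp add: dist_real_def)
    also have "\<dots> \<le> L * (dist x s + dist x y)"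
      using \<open>0 \<le> L\<close> by (intro mult_left_mono) (metis dist_commute dist_triangle)+
    finally show ?thesis by (simp add: algebra_simps)
  qed
  have bdd: "bdd_below ((\<lambda>y. u y + L * dist x y) ` S)" for x
    using lower by (intro bdd_belowI2[of S "u s - L * dist x s"]) auto
  have le: "U x \<le> U y + L * dist x y" for x y
  proof -
    have "U x - L * dist x y \<le> U y"
      unfolding U_def[of y]
    proof (rule cINF_greatest[OF False])
      fix z assume z: "z \<in> S"
      have "U x \<le> u z + L * dist x z" unfolding U_def by (rule cINF_lower[OF bdd z])
      also have "L * dist x z \<le> L * (dist x y + dist y z)"
        using \<open>0 \<le> L\<close> by (intro mult_left_mono dist_triangle) auto
      finally show "U x - L * dist x y \<le> u z + L * dist y z" by (simp add: algebra_simps)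
    qed
    then show ?thesis by simp
  qed
  show ?thesis
  proof (rule that)
    show "L-lipschitz_on UNIV U"
    proof (rule lipschitz_onI)
      show "dist (U x) (U y) \<le> L * dist x y" for x y
        using le[of x y] le[of y x] by (simp add: dist_real_def dist_commute abs_le_iff)
    qed fact
    fix x assume x: "x \<in> S"
    show "U x = u x"
    proof (rule antisym)
      show "U x \<le> u x" unfolding U_def using cINF_lower[OF bdd x, of x] by simp
      show "u x \<le> U x" unfolding U_def
      proof (rule cINF_greatest[OF False])
        fix y assume "y \<in> S"
        then show "u x \<le> u y + L * dist x y"
          using lipschitz_onD[OF lip x, of y] by (simp add: dist_real_def)
      qed
    qed
  qed
qed

lemma GDERIV_gradient:
  fixes w :: "real^'n \<Rightarrow> real"
  assumes "w differentiable (at x)"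
  shows "GDERIV w x :> gradient w x"
proof -
  obtain w' where w': "(w has_derivative w') (at x)" using assms by (auto simp: differentiable_def)
  then have "linear w'" by (rule has_derivative_linear)
  define D where "D = (\<Sum>i\<in>Basis. w' i *\<^sub>R i)"
  have "w' = (\<lambda>h. h \<bullet> D)"
  proof
    fix h
    have "w' h = w' (\<Sum>i\<in>Basis. (h \<bullet> i) *\<^sub>R i)" by (simp add: euclidean_representation)
    also have "\<dots> = (\<Sum>i\<in>Basis. (h \<bullet> i) * w' i)"
      using \<open>linear w'\<close> by (simp add: linear_sum linear_cmul)
    finally show "w' h = h \<bullet> D" by (simp add: D_def inner_sum_right mult.commute)
  qed
  then have "GDERIV w x :> D" using w' by (simp add: gderiv_def)
  then show ?thesis using gradient_eqI by metis
qed

lemma gradient_inner_eq: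
  fixes w :: "real^'n \<Rightarrow> real"
  assumes "(w has_derivative w') (at x)"
  shows "h \<bullet> gradient w x = w' h"
proof -
  have "w differentiable (at x)" using assms by (rule differentiableI)
  then have "(w has_derivative (\<lambda>h. h \<bullet> gradient w x)) (at x)"
    using GDERIV_gradient by (simp add: gderiv_def)
  then show ?thesis using has_derivative_unique[OF assms] by metis
qed

lemma gradient_cong_open:
  fixes w :: "real^'n \<Rightarrow> real"
  assumes "open S" "x \<in> S" "\<And>y. y \<in> S \<Longrightarrow> w y = w' y"
  shows "gradient w x = gradient w' x"
proof -
  have "(w has_derivative d) (at x) \<longleftrightarrow> (w' has_derivative d) (at x)" for d
    using assms by (metis has_derivative_transform_within_open)
  moreover from this have "gderiv w x = gderiv w' x"
    by (intro ext) (simp add: gderiv_def)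
  ultimately show ?thesis by (simp add: gradient_def differentiable_def)
qed

lemma has_dir_deriv_gradient:
  fixes w :: "real^'n \<Rightarrow> real"
  assumes "w differentiable (at x)"
  shows "has_dir_deriv w e x (e \<bullet> gradient w x)"
proof -
  have "(w has_derivative (\<lambda>h. h \<bullet> gradient w x)) (at (x + 0 *\<^sub>R e))"
    using GDERIV_gradient[OF assms] by (simp add: gderiv_def)
  then have "((\<lambda>t. w (x + t *\<^sub>R e)) has_derivative (\<lambda>t. (t *\<^sub>R e) \<bullet> gradient w x)) (at 0)"
    by (rule has_derivative_compose[rotated]) (auto intro!: derivative_eq_intros)
  then have "((\<lambda>t. w (x + t *\<^sub>R e)) has_real_derivative (e \<bullet> gradient w x)) (at 0)"
    by (simp add: has_field_derivative_def mult_commute_abs)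
  then show ?thesis by (simp add: has_dir_deriv_def DERIV_def)
qed

lemma norm_gradient_le:
  fixes w :: "real^'n \<Rightarrow> real"
  assumes lip: "L-lipschitz_on S w" and "open S" "x \<in> S"
  shows "norm (gradient w x) \<le> L"
proof (cases "w differentiable (at x)")
  case True
  have "0 \<le> L" using lip by (rule lipschitz_on_nonneg)
  let ?e = "gradient w x"
  obtain \<delta> where \<delta>: "\<delta> > 0" "ball x \<delta> \<subseteq> S" using assms by (meson openE)
  have "?e \<bullet> ?e \<le> L * norm ?e"
  proof (rule tendsto_le)
    show "((\<lambda>t. (w (x + t *\<^sub>R ?e) - w x) / t) \<longlongrightarrow> ?e \<bullet> ?e) (at 0)"
      using has_dir_deriv_gradient[OF True] by (simp add: has_dir_deriv_def)
    show "((\<lambda>t. L * norm ?e) \<longlongrightarrow> L * norm ?e) (at 0)" by simp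
    have "(w (x + t *\<^sub>R ?e) - w x) / t \<le> L * norm ?e" if t: "t \<noteq> 0" "\<bar>t\<bar> < \<delta> / (norm ?e + 1)" for t
    proof -
      have "\<bar>t\<bar> * norm ?e \<le> \<bar>t\<bar> * (norm ?e + 1)" by (intro mult_left_mono) auto
      also have "\<dots> < \<delta>" using t by (simp add: pos_less_divide_eq add_nonneg_pos)
      finally have "x + t *\<^sub>R ?e \<in> S" using \<delta>(2) by (auto simp: dist_norm subset_iff)
      then have "\<bar>w (x + t *\<^sub>R ?e) - w x\<bar> \<le> L * (\<bar>t\<bar> * norm ?e)"
        using lipschitz_on_normD[OF lip, of "x + t *\<^sub>R ?e" x] \<open>x \<in> S\<close> by simp
      then have "\<bar>(w (x + t *\<^sub>R ?e) - w x) / t\<bar> \<le> L * norm ?e"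
        using t by (simp add: abs_divide field_simps)
      then show ?thesis by linarith
    qed
    moreover have "\<delta> / (norm ?e + 1) > 0" using \<delta>(1) by (simp add: add_nonneg_pos)
    ultimately show "\<forall>\<^sub>F t in at 0. (w (x + t *\<^sub>R ?e) - w x) / t \<le> L * norm ?e"
      by (auto simp: eventually_at intro!: exI[of _ "\<delta> / (norm ?e + 1)"])
  qed simp
  then have "norm ?e * norm ?e \<le> L * norm ?e" by (simp add: dot_square_norm power2_eq_square)
  then show ?thesis using \<open>0 \<le> L\<close> by (cases "?e = 0") auto
next
  case False
  then show ?thesis using lipschitz_on_nonneg[OF lip] by (simp add: gradient_def)
qed

lemma differentiable_zero_gradient_at_min:
  fixes v :: "real^'n \<Rightarrow> real"
  assumes "v differentiable (at x)" "\<And>y. v x \<le> v y"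
  shows "gradient v x = 0"
proof -
  have "(v has_derivative (\<lambda>h. h \<bullet> gradient v x)) (at x)"
    using GDERIV_gradient[OF assms(1)] by (simp add: gderiv_def)
  then have "(\<lambda>h. h \<bullet> gradient v x) = (\<lambda>h. 0)"
    using assms(2) by (intro differential_zero_maxmin[of x UNIV v]) auto
  then show ?thesis by (metis inner_eq_zero_iff)
qed

text \<open>
  The mean value theorem on the segment from \<open>x\<^sub>0\<close> to \<open>x\<close>, applied to the restriction of \<open>phi\<close> minus its
  quadratic expansion: the derivative there is controlled by the differentiability of the
  gradient at \<open>x\<^sub>0\<close>.
\<close>

lemma second_order_taylor:
  fixes phi :: "real^'n \<Rightarrow> real"
  assumes "open S" "x0 \<in> S" and diff: "\<And>x. x \<in> S \<Longrightarrow> phi differentiable (at x)"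
    and diff2: "gradient phi differentiable (at x0)" and "0 < \<epsilon>"
  shows "\<forall>\<^sub>F x in at x0. \<bar>phi x - (phi x0 + gradient phi x0 \<bullet> (x - x0) +
      (hessian phi x0 *v (x - x0)) \<bullet> (x - x0) / 2)\<bar> \<le> \<epsilon> * (norm (x - x0))\<^sup>2"
proof -
  let ?X = "hessian phi x0" and ?p = "gradient phi x0"
  have "(gradient phi has_derivative (\<lambda>h. ?X *v h)) (at x0)"
    using diff2 unfolding hessian_def by (simp add: jacobian_works)
  then obtain d where d: "d > 0"
    "\<And>y. norm (y - x0) < d \<Longrightarrow> norm (gradient phi y - ?p - ?X *v (y - x0)) \<le> \<epsilon> * norm (y - x0)"
    unfolding has_derivative_at_alt using \<open>0 < \<epsilon>\<close> by blast
  obtain e where e: "e > 0" "ball x0 e \<subseteq> S" using assms by (meson openE)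
  have "\<bar>phi x - (phi x0 + ?p \<bullet> (x - x0) + (?X *v (x - x0)) \<bullet> (x - x0) / 2)\<bar> \<le> \<epsilon> * (norm (x - x0))\<^sup>2"
    if x: "norm (x - x0) < min d e" for x
  proof -
    define h where "h = x - x0"
    define F where "F t = phi (x0 + t *\<^sub>R h) - t * (?p \<bullet> h) - t\<^sup>2 / 2 * ((?X *v h) \<bullet> h)" for t
    define F' where "F' t = (gradient phi (x0 + t *\<^sub>R h) - ?p - ?X *v (t *\<^sub>R h)) \<bullet> h" for t
    have small: "norm (t *\<^sub>R h) < min d e" if "t \<in> {0..1}" for t
      using that x mult_left_le_one_le[of "norm h" t] by (simp add: h_def)
    have F': "(F has_real_derivative F' t) (at t)" if t: "t \<in> {0..1}" for t
    proof -
      have "x0 + t *\<^sub>R h \<in> S" using small[OF t] e(2) by (auto simp: dist_norm subset_iff)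
      then have "(phi has_derivative (\<lambda>k. k \<bullet> gradient phi (x0 + t *\<^sub>R h))) (at (x0 + t *\<^sub>R h))"
        using GDERIV_gradient[OF diff] by (simp add: gderiv_def)
      then have "((\<lambda>t. phi (x0 + t *\<^sub>R h)) has_derivative (\<lambda>s. (s *\<^sub>R h) \<bullet> gradient phi (x0 + t *\<^sub>R h))) (at t)"
        by (rule has_derivative_compose[rotated]) (auto intro!: derivative_eq_intros)
      then have "((\<lambda>t. phi (x0 + t *\<^sub>R h)) has_real_derivative (h \<bullet> gradient phi (x0 + t *\<^sub>R h))) (at t)"
        by (simp add: has_field_derivative_def mult_commute_abs)
      then show ?thesis unfolding F_def[abs_def] F'_def
        by (auto intro!: derivative_eq_intros simp: inner_diff_right matrix_vector_mult_scaleR inner_commute)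
    qed
    obtain t where t: "0 < t" "t < 1" "F 1 - F 0 = (1 - 0) * F' t"
      using MVT2[of 0 1 F F'] F' by auto
    have "\<bar>F' t\<bar> \<le> norm (gradient phi (x0 + t *\<^sub>R h) - ?p - ?X *v (t *\<^sub>R h)) * norm h"
      unfolding F'_def by (rule Cauchy_Schwarz_ineq2)
    also have "\<dots> \<le> \<epsilon> * norm (t *\<^sub>R h) * norm h"
      using d(2)[of "x0 + t *\<^sub>R h"] small[of t] t by (intro mult_right_mono) auto
    also have "\<dots> \<le> \<epsilon> * (norm h)\<^sup>2"
      using t \<open>0 < \<epsilon>\<close> by (simp add: power2_eq_square mult_left_le_one_le)
    finally have "\<bar>F 1 - F 0\<bar> \<le> \<epsilon> * (norm h)\<^sup>2" using t by simp
    moreover have "F 1 - F 0 = phi x - (phi x0 + ?p \<bullet> (x - x0) + (?X *v (x - x0)) \<bullet> (x - x0) / 2)"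
      by (simp add: F_def h_def)
    ultimately show ?thesis by (simp only: h_def)
  qed
  then show ?thesis unfolding eventually_at dist_norm
    using d(1) e(1) by (intro exI[of _ "min d e"]) auto
qed

section \<open>Integration by parts for Lipschitz functions\<close>

lemma AE_lebesgue_differentiable:
  fixes v :: "real^'n \<Rightarrow> real"
  assumes "L-lipschitz_on UNIV v"
  shows "AE x in lebesgue. v differentiable (at x)"
  using AE_differentiable_if_lipschitz[OF assms] by (rule AE_completion)

lemma gradient_tendsto:
  fixes v :: "real^'n \<Rightarrow> real"
  assumes "v differentiable (at x)"
  shows "(\<lambda>n. (v (x + (1 / real (Suc n)) *\<^sub>R e) - v x) / (1 / real (Suc n))) \<longlonglongrightarrow> e \<bullet> gradient v x"
proof -
  have "filterlim (\<lambda>n. 1 / real (Suc n)) (at 0) sequentially"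
    unfolding filterlim_at using LIMSEQ_Suc[OF lim_1_over_n] by (auto intro!: always_eventually)
  from filterlim_compose[OF has_dir_deriv_gradient[OF assms, of e, unfolded has_dir_deriv_def] this]
  show ?thesis .
qed

text \<open>
  Away from a null set the gradient is a limit of difference quotients; on that null set it is \<open>0\<close> by
  definition.
\<close>

lemma gradient_measurable:
  fixes v :: "real^'n \<Rightarrow> real"
  assumes lip: "L-lipschitz_on UNIV v"
  shows "gradient v \<in> borel_measurable lebesgue"
proof -
  have "(\<lambda>x. gradient v x \<bullet> e) \<in> borel_measurable lebesgue" for e
  proof -
    have [measurable]: "v \<in> borel_measurable lborel"
      using lipschitz_on_continuous_on[OF lip] by (simp add: borel_measurable_continuous_onI)
    let ?s = "\<lambda>n x. (v (x + (1 / real (Suc n)) *\<^sub>R e) - v x) / (1 / real (Suc n))"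
    define N where "N = {x. \<not> v differentiable (at x)}"
    have "N \<in> null_sets lebesgue"
      using AE_lebesgue_differentiable[OF lip] unfolding N_def
      by (simp add: completion.AE_iff_null_sets null_sets_completion_iff2 AE_iff_null_sets)
    then have N: "N \<in> sets lebesgue" by auto
    have "(\<lambda>x. lim (\<lambda>n. ?s n x)) \<in> borel_measurable lborel"
      by (rule borel_measurable_lim_metric) measurable
    then have "(\<lambda>x. lim (\<lambda>n. ?s n x)) \<in> borel_measurable lebesgue"
      by (rule measurable_completion)
    then have "(\<lambda>x. if x \<in> N then 0 else lim (\<lambda>n. ?s n x)) \<in> borel_measurable lebesgue"
      using N by (intro measurable_If_set) auto
    also have "(\<lambda>x. if x \<in> N then 0 else lim (\<lambda>n. ?s n x)) = (\<lambda>x. gradient v x \<bullet> e)"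
    proof
      fix x
      show "(if x \<in> N then 0 else lim (\<lambda>n. ?s n x)) = gradient v x \<bullet> e"
      proof (cases "x \<in> N")
        case True
        then show ?thesis by (simp add: N_def gradient_def)
      next
        case False
        then show ?thesis
          using limI[OF gradient_tendsto[of v x e]] by (simp add: N_def inner_commute)
      qed
    qed
    finally show ?thesis .
  qed
  then show ?thesis by (subst borel_measurable_euclidean_space) auto
qed

lemma integrable_compactly_supported:
  fixes h :: "'a::euclidean_space \<Rightarrow> real"
  assumes cont: "continuous_on UNIV h" and supp: "\<And>x. x \<notin> cball a R \<Longrightarrow> h x = 0"
  shows "integrable lborel h"
proof -
  have "set_integrable lborel (cball a R) h"
    unfolding set_integrable_def using cont
    by (intro borel_integrable_compact) (auto intro: continuous_on_subset)
  moreover have "(\<lambda>x. indicat_real (cball a R) x *\<^sub>R h x) = h"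
    using supp by (auto simp: indicator_def fun_eq_iff)
  ultimately show ?thesis unfolding set_integrable_def by simp
qed

text \<open>
  Translation invariance makes the integrals of the difference quotients vanish, and the Lipschitz bound
  dominates them on a ball that contains all their supports.
\<close>

lemma integral_gradient_eq_zero:
  fixes h :: "real^'n \<Rightarrow> real"
  assumes lip: "K-lipschitz_on UNIV h" and supp: "\<And>x. x \<notin> cball a R \<Longrightarrow> h x = 0"
  shows "integrable lebesgue (\<lambda>x. gradient h x \<bullet> e)"
    and "integral\<^sup>L lebesgue (\<lambda>x. gradient h x \<bullet> e) = 0"
proof -
  have "0 \<le> K" using lip by (rule lipschitz_on_nonneg)
  have cont: "continuous_on UNIV h" by (rule lipschitz_on_continuous_on[OF lip])
  then have [measurable]: "h \<in> borel_measurable borel" by (rule borel_measurable_continuous_onI)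
  define c where "c n = 1 / real (Suc n)" for n
  let ?s = "\<lambda>n x. (h (x + c n *\<^sub>R e) - h x) / c n"
  let ?w = "\<lambda>x. (K * norm e) * indicat_real (cball a (R + norm e)) x"
  have c: "0 < c n" "c n \<le> 1" for n by (auto simp: c_def)
  have int_h: "integrable lborel h"
    using cont supp by (rule integrable_compactly_supported)
  have shift: "integrable lborel (\<lambda>x. h (x + d))" "(\<integral>x. h (x + d) \<partial>lborel) = (\<integral>x. h x \<partial>lborel)" for d
  proof -
    have "integrable (distr lborel borel ((+) d)) h" using int_h by (simp only: lborel_distr_plus)
    then show "integrable lborel (\<lambda>x. h (x + d))" by (subst (asm) integrable_distr_eq) (auto simp: add.commute)
    have "(\<integral>x. h x \<partial>lborel) = (\<integral>x. h x \<partial>distr lborel borel ((+) d))" by (simp only: lborel_distr_plus)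
    also have "\<dots> = (\<integral>x. h (d + x) \<partial>lborel)" by (rule integral_distr) auto
    finally show "(\<integral>x. h (x + d) \<partial>lborel) = (\<integral>x. h x \<partial>lborel)" by (simp add: add.commute)
  qed
  have s0: "integral\<^sup>L lebesgue (?s n) = 0" for n
  proof -
    have "integral\<^sup>L lebesgue (?s n) = integral\<^sup>L lborel (?s n)" by (rule integral_completion) measurable
    also have "\<dots> = 0" using shift int_h by (simp add: integral_diff)
    finally show ?thesis .
  qed
  have lim: "AE x in lebesgue. (\<lambda>n. ?s n x) \<longlonglongrightarrow> gradient h x \<bullet> e"
    using AE_lebesgue_differentiable[OF lip]
  proof eventually_elim
    case (elim x)
    then show ?case using gradient_tendsto[OF elim, of e] by (simp add: c_def inner_commute)
  qed
  have bound: "norm (?s n x) \<le> ?w x" for n x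
  proof (cases "x \<in> cball a (R + norm e)")
    case True
    have "\<bar>h (x + c n *\<^sub>R e) - h x\<bar> \<le> K * (c n * norm e)"
      using lipschitz_on_normD[OF lip, of "x + c n *\<^sub>R e" x] c[of n] by simp
    then show ?thesis using True c[of n] by (simp add: field_simps)
  next
    case False
    have "c n * norm e \<le> norm e" using c[of n] by (simp add: mult_left_le_one_le)
    moreover have "dist a x \<le> dist a (x + c n *\<^sub>R e) + c n * norm e"
      using dist_triangle[of a x "x + c n *\<^sub>R e"] c[of n] by (simp add: dist_norm)
    ultimately have "x + c n *\<^sub>R e \<notin> cball a R" "x \<notin> cball a R" 
      using False norm_ge_zero[of e] unfolding mem_cball by linarith+
    then show ?thesis using False supp by simp
  qed
  have meas: "(\<lambda>x. gradient h x \<bullet> e) \<in> borel_measurable lebesgue"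
    using gradient_measurable[OF lip] by simp
  have sm: "?s n \<in> borel_measurable lebesgue" for n
    by (rule measurable_completion) measurable
  have w: "integrable lebesgue ?w"
    using lmeasurable_cball[of a "R + norm e"]
    by (intro integrable_mult_right integrable_real_indicator) (auto simp: fmeasurable_def)
  show "integrable lebesgue (\<lambda>x. gradient h x \<bullet> e)"
    by (rule integrable_dominated_convergence[OF meas sm w lim]) (use bound in auto)
  have "(\<lambda>n. integral\<^sup>L lebesgue (?s n)) \<longlonglongrightarrow> integral\<^sup>L lebesgue (\<lambda>x. gradient h x \<bullet> e)"
    by (rule integral_dominated_convergence[OF meas sm w lim]) (use bound in auto)
  then show "integral\<^sup>L lebesgue (\<lambda>x. gradient h x \<bullet> e) = 0"
    by (simp only: s0 LIMSEQ_const_iff)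
qed

text \<open>
  Half the radius is left as a margin: from the support to the outside of the ball the distance is at
  least \<open>r / 2\<close>, so boundedness of \<open>v\<close> already gives a Lipschitz estimate there.
\<close>

lemma lipschitz_on_UNIV_if_compactly_supported:
  fixes v :: "'a::real_normed_vector \<Rightarrow> 'b::real_normed_vector"
  assumes lip: "K-lipschitz_on (cball a r) v" and "0 < r"
    and supp: "\<And>x. x \<notin> cball a (r / 2) \<Longrightarrow> v x = 0"
  obtains K' where "K'-lipschitz_on UNIV v"
proof -
  have "0 \<le> K" using lip by (rule lipschitz_on_nonneg)
  define M where "M = norm (v a) + K * r"
  have "0 \<le> M" using \<open>0 \<le> K\<close> \<open>0 < r\<close> by (simp add: M_def)
  have bound: "norm (v x) \<le> M" if "x \<in> cball a r" for x
  proof -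
    have "norm (v x - v a) \<le> K * norm (x - a)"
      using lipschitz_on_normD[OF lip that] \<open>0 < r\<close> by simp
    also have "\<dots> \<le> K * r"
      using that \<open>0 \<le> K\<close> by (intro mult_left_mono) (auto simp: dist_norm norm_minus_commute)
    finally show ?thesis unfolding M_def using norm_triangle_sub[of "v x" "v a"] by linarith
  qed
  have mixed: "norm (v x - v y) \<le> 2 * M / r * norm (x - y)" if "x \<in> cball a r" "y \<notin> cball a r" for x y
  proof (cases "x \<in> cball a (r / 2)")
    case True
    have "v y = 0" using that(2) \<open>0 < r\<close> by (intro supp) auto
    have "r / 2 \<le> norm (x - y)"
      using True that(2) dist_triangle[of a y x] by (simp add: dist_norm)
    then have "M * 1 \<le> M * (2 / r * norm (x - y))"
      using \<open>0 < r\<close> \<open>0 \<le> M\<close> by (intro mult_left_mono) (auto simp: field_simps)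
    then show ?thesis using bound[OF that(1)] \<open>v y = 0\<close> by (simp add: mult_ac)
  next
    case False
    then have "v x = 0" "v y = 0" using that(2) \<open>0 < r\<close> by (auto intro!: supp)
    then show ?thesis using \<open>0 \<le> M\<close> \<open>0 < r\<close> by simp
  qed
  have "(K + 2 * M / r)-lipschitz_on UNIV v"
  proof (rule lipschitz_onI)
    fix x y :: 'a
    have nn: "0 \<le> K * norm (x - y)" "0 \<le> 2 * M / r * norm (x - y)"
      using \<open>0 \<le> K\<close> \<open>0 \<le> M\<close> \<open>0 < r\<close> by auto
    have "norm (v x - v y) \<le> K * norm (x - y) + 2 * M / r * norm (x - y)"
    proof (cases "x \<in> cball a r"; cases "y \<in> cball a r")
      assume "x \<in> cball a r" "y \<in> cball a r"
      then show ?thesis using lipschitz_on_normD[OF lip, of x y] nn by linarith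
    next
      assume "x \<in> cball a r" "y \<notin> cball a r"
      then show ?thesis using mixed[of x y] nn by linarith
    next
      assume "x \<notin> cball a r" "y \<in> cball a r"
      then show ?thesis using mixed[of y x] nn by (simp add: norm_minus_commute)
    next
      assume "x \<notin> cball a r" "y \<notin> cball a r"
      then have "v x = 0" "v y = 0" using \<open>0 < r\<close> by (auto intro!: supp)
      then show ?thesis using nn by simp
    qed
    then show "dist (v x) (v y) \<le> (K + 2 * M / r) * dist x y"
      by (simp add: dist_norm algebra_simps)
  qed (use \<open>0 \<le> K\<close> \<open>0 \<le> M\<close> \<open>0 < r\<close> in auto)
  then show ?thesis by (rule that)
qed

lemma lipschitz_on_scaleR_compact:
  fixes f :: "'a::metric_space \<Rightarrow> real" and G :: "'a \<Rightarrow> 'b::real_normed_vector"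
  assumes f: "K-lipschitz_on S f" and G: "M-lipschitz_on S G" and "compact S"
  obtains C where "C-lipschitz_on S (\<lambda>x. f x *\<^sub>R G x)"
proof -
  obtain a where a: "\<And>x. x \<in> S \<Longrightarrow> \<bar>f x\<bar> \<le> a" "0 < a"
    using compact_imp_bounded[OF compact_continuous_image[OF lipschitz_on_continuous_on[OF f] \<open>compact S\<close>]]
    unfolding bounded_pos by auto
  obtain b where b: "\<And>x. x \<in> S \<Longrightarrow> norm (G x) \<le> b" "0 < b"
    using compact_imp_bounded[OF compact_continuous_image[OF lipschitz_on_continuous_on[OF G] \<open>compact S\<close>]]
    unfolding bounded_pos by auto
  have "0 \<le> K" "0 \<le> M" using f G by (auto dest: lipschitz_on_nonneg)
  have "(a * M + K * b)-lipschitz_on S (\<lambda>x. f x *\<^sub>R G x)"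
  proof (rule lipschitz_onI)
    fix x y assume xy: "x \<in> S" "y \<in> S"
    have "f x *\<^sub>R G x - f y *\<^sub>R G y = f x *\<^sub>R (G x - G y) + (f x - f y) *\<^sub>R G y"
      by (simp add: algebra_simps)
    then have "norm (f x *\<^sub>R G x - f y *\<^sub>R G y) \<le> \<bar>f x\<bar> * norm (G x - G y) + \<bar>f x - f y\<bar> * norm (G y)"
      using norm_triangle_ineq[of "f x *\<^sub>R (G x - G y)" "(f x - f y) *\<^sub>R G y"] by simp
    also have "\<dots> \<le> a * (M * dist x y) + (K * dist x y) * b"
      using a b xy lipschitz_onD[OF f xy] lipschitz_onD[OF G xy] \<open>0 \<le> K\<close>
      by (intro add_mono mult_mono) (auto simp: dist_norm dist_real_def intro: less_imp_le)
    finally show "dist (f x *\<^sub>R G x) (f y *\<^sub>R G y) \<le> (a * M + K * b) * dist x y"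
      by (simp add: dist_norm algebra_simps)
  qed (use \<open>0 \<le> K\<close> \<open>0 \<le> M\<close> a b in auto)
  then show ?thesis by (rule that)
qed

text \<open>
  The function \<open>g\<close> is the divergence of the field \<open>v G\<close>, which is Lipschitz and compactly supported although
  \<open>G\<close> is controlled only on a ball; the product rule holds wherever \<open>v\<close> is differentiable. Keeping the
  two terms of the product rule together in one integrable function avoids discussing the
  measurability of each.
\<close>

lemma weak_divergence_theorem:
  fixes v :: "real^'n \<Rightarrow> real" and G :: "real^'n \<Rightarrow> real^'n"
  assumes lip: "K-lipschitz_on UNIV v" and supp: "\<And>x. x \<notin> cball a (r / 2) \<Longrightarrow> v x = 0" and "0 < r"
    and G: "C-lipschitz_on (cball a r) G"
    and G': "\<And>x. x \<in> ball a r \<Longrightarrow> (G has_derivative G' x) (at x)"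
  obtains g where "integrable lebesgue g" "integral\<^sup>L lebesgue g = 0" "\<And>x. x \<notin> ball a r \<Longrightarrow> g x = 0"
    "AE x in lebesgue. x \<in> ball a r \<longrightarrow>
       g x = gradient v x \<bullet> G x + v x * (\<Sum>i\<in>Basis. G' x i \<bullet> i)"
proof -
  obtain C' where "C'-lipschitz_on (cball a r) (\<lambda>x. v x *\<^sub>R G x)"
    using lipschitz_on_scaleR_compact[OF lipschitz_on_subset[OF lip] G compact_cball] by auto
  then obtain M where M: "M-lipschitz_on UNIV (\<lambda>x. v x *\<^sub>R G x)"
    using lipschitz_on_UNIV_if_compactly_supported[of C' a r "\<lambda>x. v x *\<^sub>R G x"] \<open>0 < r\<close> supp by auto
  define h where "h i x = v x * (G x \<bullet> i)" for i x
  have h_lip: "M-lipschitz_on UNIV (h i)" if i: "i \<in> Basis" for i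
  proof (rule lipschitz_onI)
    fix x y
    have "dist (h i x) (h i y) = \<bar>(v x *\<^sub>R G x - v y *\<^sub>R G y) \<bullet> i\<bar>"
      by (simp add: h_def dist_real_def inner_diff_left)
    also have "\<dots> \<le> norm (v x *\<^sub>R G x - v y *\<^sub>R G y)" using Basis_le_norm[OF i] by blast
    also have "\<dots> \<le> M * dist x y" using lipschitz_onD[OF M, of x y] by (simp add: dist_norm)
    finally show "dist (h i x) (h i y) \<le> M * dist x y" .
  qed (use lipschitz_on_nonneg[OF M] in simp)
  have h_supp: "h i x = 0" if "x \<notin> cball a (r / 2)" for i x
    using supp[OF that] by (simp add: h_def)
  define g where "g x = (\<Sum>i\<in>Basis. gradient (h i) x \<bullet> i)" for x
  show ?thesis
  proof (rule that)
    show "integrable lebesgue g" unfolding g_def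
      by (intro Bochner_Integration.integrable_sum integral_gradient_eq_zero(1)[OF h_lip h_supp])
    show "integral\<^sup>L lebesgue g = 0" unfolding g_def
      by (subst Bochner_Integration.integral_sum)
        (auto intro!: integral_gradient_eq_zero[OF h_lip h_supp] sum.neutral)
    show "g x = 0" if "x \<notin> ball a r" for x
    proof -
      have x: "x \<in> - cball a (r / 2)" using that \<open>0 < r\<close> by auto
      have "gradient (h i) x = gradient (\<lambda>x. 0) x" for i
        by (rule gradient_cong_open[OF _ x]) (auto intro!: h_supp)
      also have "gradient (\<lambda>x. 0) x = 0" by (rule gradient_eqI) (rule GDERIV_const)
      finally show ?thesis by (simp add: g_def)
    qed
    show "AE x in lebesgue. x \<in> ball a r \<longrightarrow>
        g x = gradient v x \<bullet> G x + v x * (\<Sum>i\<in>Basis. G' x i \<bullet> i)"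
      using AE_lebesgue_differentiable[OF lip]
    proof eventually_elim
      case (elim x)
      show ?case
      proof
        assume x: "x \<in> ball a r"
        have v': "(v has_derivative (\<lambda>k. k \<bullet> gradient v x)) (at x)"
          using GDERIV_gradient[OF elim] by (simp add: gderiv_def)
        have "gradient (h i) x \<bullet> i = (i \<bullet> gradient v x) * (G x \<bullet> i) + v x * (G' x i \<bullet> i)" for i
        proof -
          have "(h i has_derivative (\<lambda>k. v x * (G' x k \<bullet> i) + (k \<bullet> gradient v x) * (G x \<bullet> i))) (at x)"
            unfolding h_def[abs_def]
            by (intro has_derivative_mult v' has_derivative_inner_left G' x)
          from gradient_inner_eq[OF this, of i] show ?thesis by (simp add: inner_commute)
        qed
        moreover have "(\<Sum>i\<in>Basis. (i \<bullet> gradient v x) * (G x \<bullet> i)) = gradient v x \<bullet> G x"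
          by (subst euclidean_inner) (simp add: inner_commute[of "gradient v x"])
        ultimately show "g x = gradient v x \<bullet> G x + v x * (\<Sum>i\<in>Basis. G' x i \<bullet> i)"
          by (simp only: g_def sum.distrib sum_distrib_left)
      qed
    qed
  qed
qed

section \<open>The energy density and its flux\<close>

lemma sum_Basis_vec: "(\<Sum>i\<in>Basis. F i) = (\<Sum>j\<in>UNIV. F (axis j (1::real)))"
  for F :: "real^'n \<Rightarrow> 'b::comm_monoid_add"
proof -
  have B: "(Basis :: (real^'n) set) = range (\<lambda>j. axis j 1)" by (auto simp: Basis_vec_def)
  have "inj (\<lambda>j::'n. axis j (1::real))" by (auto simp: inj_def axis_eq_axis)
  then show ?thesis by (simp only: B sum.reindex o_def)
qed

locale integrand =
  fixes f f' f'' :: "real \<Rightarrow> real" and lam :: real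
  assumes strictly_convex: "strictly_convex_on {0..} f"
    and deriv_f: "\<And>r. r \<ge> 0 \<Longrightarrow> (f has_real_derivative f' r) (at r within {0..})"
    and cont_f': "continuous_on {0..} f'"
    and deriv_f': "\<And>r. r > 0 \<Longrightarrow> (f' has_real_derivative f'' r) (at r)"
    and lam_pos: "0 < lam" and holder_f'': "locally_holder_on lam {0<..} f''"
    and f'_0_pos: "f' 0 > 0"
begin

lemma tangent_le:
  assumes "0 < c" "0 \<le> s"
  shows "f c + f' c * (s - c) \<le> f s"
proof -
  have "convex_on {0..} f"
  proof (rule convex_onI)
    fix t x y :: real assume "0 < t" "t < 1" "x \<in> {0..}" "y \<in> {0..}"
    then show "f ((1 - t) *\<^sub>R x + t *\<^sub>R y) \<le> (1 - t) * f x + t * f y"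
    proof (cases "x = y")
      case False
      then have "f ((1 - t) * x + t * y) < (1 - t) * f x + t * f y"
        using strictly_convex \<open>0 < t\<close> \<open>t < 1\<close> \<open>x \<in> {0..}\<close> \<open>y \<in> {0..}\<close>
        unfolding strictly_convex_on_def by blast
      then show ?thesis by simp
    qed (simp add: algebra_simps)
  qed simp
  then have "f s - f c \<ge> f' c * (s - c)"
    using assms deriv_f[of c] by (intro convex_on_imp_above_tangent[of "{0..}"]) auto
  then show ?thesis by simp
qed

text \<open>
  The derivative is positive near \<open>0\<close> by continuity, and nondecreasing by the tangent inequalities at two
  points.
\<close>

lemma f'_pos:
  assumes "0 < r"
  shows "0 < f' r"
proof -
  have mono: "f' a \<le> f' b" if "0 < a" "a < b" for a b
  proof -
    have "f' a * (b - a) \<le> f' b * (b - a)"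
      using tangent_le[of a b] tangent_le[of b a] that by (simp add: algebra_simps)
    then show ?thesis using that by simp
  qed
  have "(f' \<longlongrightarrow> f' 0) (at 0 within {0..})"
    using cont_f' by (simp add: continuous_on_def)
  then have "eventually (\<lambda>s. 0 < f' s) (at 0 within {0..})"
    using f'_0_pos by (rule order_tendstoD(1))
  then obtain d where d: "d > 0" "\<And>s. s > 0 \<Longrightarrow> s < d \<Longrightarrow> 0 < f' s"
    by (auto simp: eventually_at dist_real_def)
  define s where "s = min d r / 2"
  have "0 < s" "s < d" "s < r" using d(1) \<open>0 < r\<close> by (auto simp: s_def)
  then show ?thesis using d(2)[of s] mono[of s r] by linarith
qed

lemma isCont_f':
  assumes "0 < r"
  shows "isCont f' r"
  using deriv_f'[OF assms] by (rule DERIV_isCont)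

text \<open>
  Continuity, read off from the Hoelder estimate on a compact interval around \<open>r\<close>.
\<close>

lemma isCont_f'':
  assumes "0 < r"
  shows "isCont f'' r"
proof -
  let ?K = "{r / 2..2 * r}"
  have "compact ?K" "?K \<subseteq> {0<..}" using assms by auto
  then obtain C where C: "\<And>x y. x \<in> ?K \<Longrightarrow> y \<in> ?K \<Longrightarrow> \<bar>f'' x - f'' y\<bar> \<le> C * \<bar>x - y\<bar> powr lam"
    using holder_f'' unfolding locally_holder_on_def by meson
  have "((\<lambda>x. \<bar>x - r\<bar>) \<longlongrightarrow> \<bar>r - r\<bar>) (at r)" by (intro tendsto_intros)
  then have "((\<lambda>x. \<bar>x - r\<bar> powr lam) \<longlongrightarrow> 0) (at r)"
    using lam_pos by (intro tendsto_zero_powrI[where b = lam]) auto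
  then have lim0: "((\<lambda>x. C * \<bar>x - r\<bar> powr lam) \<longlongrightarrow> 0) (at r)"
    by (rule tendsto_mult_right_zero)
  have "eventually (\<lambda>x. x \<in> {r / 2<..<2 * r}) (at r)"
    using assms by (intro eventually_at_in_open') auto
  then have "eventually (\<lambda>x. norm (f'' x - f'' r) \<le> C * \<bar>x - r\<bar> powr lam) (at r)"
    by eventually_elim (use C[of _ r] assms in auto)
  then have "((\<lambda>x. f'' x - f'' r) \<longlongrightarrow> 0) (at r)"
    by (rule Lim_null_comparison) (rule lim0)
  then show ?thesis unfolding isCont_def by (rule LIM_zero_cancel)
qed

text \<open>
  The gradient of \<open>a \<mapsto> f (norm a)\<close> at \<open>a \<noteq> 0\<close>.
\<close>

definition flux :: "real^'n \<Rightarrow> real^'n" where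
  "flux a = (f' (norm a) / norm a) *\<^sub>R a"

definition flux_derivative :: "real^'n \<Rightarrow> real^'n \<Rightarrow> real^'n" where
  "flux_derivative a h = (f' (norm a) / norm a) *\<^sub>R h +
     ((f'' (norm a) / norm a - f' (norm a) / (norm a)\<^sup>2) * (a \<bullet> h) / norm a) *\<^sub>R a"

text \<open>
  Convexity of \<open>a \<mapsto> f (norm a)\<close> in tangent form: the tangent inequality for \<open>f\<close> at \<open>norm a\<close>, combined with the
  Cauchy--Schwarz inequality, whose use requires that \<open>f'\<close> be nonnegative.
\<close>

lemma density_above_tangent:
  fixes a b :: "real^'n"
  assumes "a \<noteq> 0"
  shows "f (norm a) + flux a \<bullet> (b - a) \<le> f (norm b)"
proof -
  have "0 < norm a" using assms by simp
  have "flux a \<bullet> (b - a) = f' (norm a) * ((a \<bullet> b) / norm a - norm a)"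
    using assms by (simp add: flux_def inner_diff_right dot_square_norm power2_eq_square field_simps)
  also have "\<dots> \<le> f' (norm a) * (norm b - norm a)"
  proof (rule mult_left_mono)
    show "(a \<bullet> b) / norm a - norm a \<le> norm b - norm a"
      using norm_cauchy_schwarz[of a b] \<open>0 < norm a\<close> by (simp add: field_simps)
  qed (use f'_pos[OF \<open>0 < norm a\<close>] in simp)
  finally show ?thesis using tangent_le[OF \<open>0 < norm a\<close>, of "norm b"] by simp
qed

lemma DERIV_quotient:
  assumes "0 < r"
  shows "((\<lambda>r. f' r / r) has_real_derivative f'' r / r - f' r / r\<^sup>2) (at r)"
  using assms by (auto intro!: derivative_eq_intros deriv_f' simp: field_simps power2_eq_square)

lemma flux_has_derivative:
  fixes a :: "real^'n"
  assumes "a \<noteq> 0"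
  shows "(flux has_derivative flux_derivative a) (at a)"
proof -
  have "((\<lambda>a. f' (norm a) / norm a) has_derivative
      (\<lambda>h. (f'' (norm a) / norm a - f' (norm a) / (norm a)\<^sup>2) * (h \<bullet> sgn a))) (at a)"
    using has_derivative_compose[OF has_derivative_norm[OF assms]
        DERIV_quotient[of "norm a", unfolded has_field_derivative_def]] assms by simp
  from has_derivative_scaleR[OF this has_derivative_ident]
  have "(flux has_derivative (\<lambda>h. (f' (norm a) / norm a) *\<^sub>R h +
      ((f'' (norm a) / norm a - f' (norm a) / (norm a)\<^sup>2) * (h \<bullet> sgn a)) *\<^sub>R a)) (at a)"
    by (simp add: flux_def[abs_def])
  moreover have "h \<bullet> sgn a = (a \<bullet> h) / norm a" for h
    by (simp add: sgn_div_norm inner_commute divide_inverse mult.commute)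
  ultimately show ?thesis by (simp add: flux_derivative_def[abs_def])
qed

text \<open>
  The divergence of \<open>x \<mapsto> flux (q x)\<close> for an affine field \<open>q\<close> with linear part \<open>A\<close>.
\<close>

lemma sum_flux_derivative:
  fixes a :: "real^'n" and A :: "real^'n^'n"
  shows "(\<Sum>i\<in>Basis. flux_derivative a (A *v i) \<bullet> i) =
    (f' (norm a) / norm a) * trace A +
    (f'' (norm a) / norm a - f' (norm a) / (norm a)\<^sup>2) / norm a * ((A *v a) \<bullet> a)"
proof -
  let ?c = "f' (norm a) / norm a"
  let ?k = "(f'' (norm a) / norm a - f' (norm a) / (norm a)\<^sup>2) / norm a"
  have tr: "(\<Sum>i\<in>Basis. (A *v i) \<bullet> i) = trace A"
    by (simp add: sum_Basis_vec trace_def inner_axis matrix_vector_mul_component)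
  have "(\<Sum>i\<in>Basis. (a \<bullet> (A *v i)) * (a \<bullet> i)) = a \<bullet> (A *v (\<Sum>i\<in>Basis. (a \<bullet> i) *\<^sub>R i))"
    by (simp add: linear_sum[OF matrix_vector_mul_linear] matrix_vector_mult_scaleR inner_sum_right mult.commute)
  also have "\<dots> = (A *v a) \<bullet> a" unfolding euclidean_representation by (rule inner_commute)
  finally have quad: "(\<Sum>i\<in>Basis. (a \<bullet> (A *v i)) * (a \<bullet> i)) = (A *v a) \<bullet> a" .
  have "(\<Sum>i\<in>Basis. flux_derivative a (A *v i) \<bullet> i) =
      (\<Sum>i\<in>Basis. ?c * ((A *v i) \<bullet> i) + ?k * ((a \<bullet> (A *v i)) * (a \<bullet> i)))"
    by (intro sum.cong) (auto simp: flux_derivative_def inner_add_left)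
  also have "\<dots> = ?c * trace A + ?k * ((A *v a) \<bullet> a)"
    by (simp only: sum.distrib sum_distrib_left[symmetric] tr quad)
  finally show ?thesis .
qed

lemma flux_affine_lipschitz:
  fixes p x0 :: "real^'n" and A :: "real^'n^'n"
  assumes bounds: "\<And>x. x \<in> cball x0 r \<Longrightarrow> norm (p + A *v (x - x0)) \<in> {m..M}" and "0 < m"
  obtains C where "C-lipschitz_on (cball x0 r) (\<lambda>x. flux (p + A *v (x - x0)))"
proof -
  let ?d = "\<lambda>r. f'' r / r - f' r / r\<^sup>2"
  have "continuous_on {m..M} ?d"
    using \<open>0 < m\<close> by (intro continuous_at_imp_continuous_on ballI continuous_intros)
      (auto intro!: isCont_f' isCont_f'' continuous_intros)
  then have "bounded (?d ` {m..M})" by (intro compact_imp_bounded compact_continuous_image) auto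
  then obtain B where B: "0 < B" "\<And>r. r \<in> {m..M} \<Longrightarrow> \<bar>?d r\<bar> \<le> B"
    unfolding bounded_pos by auto
  have onorm_mult: "onorm ((*) c) = \<bar>c\<bar>" for c :: real
    using onorm_scaleR_left[OF bounded_linear_ident, of c] by (simp add: onorm_id mult_commute_abs)
  have quot: "B-lipschitz_on {m..M} (\<lambda>r. f' r / r)"
  proof (rule bounded_derivative_imp_lipschitz)
    fix r assume r: "r \<in> {m..M}"
    show "((\<lambda>r. f' r / r) has_derivative (*) (?d r)) (at r within {m..M})"
      using r \<open>0 < m\<close>
      by (intro has_field_derivative_at_within[OF DERIV_quotient, unfolded has_field_derivative_def]) auto
    show "onorm ((*) (?d r)) \<le> B" using B(2)[OF r] onorm_mult by simp
  qed (use B in auto)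
  obtain b where b: "b > 0" "\<And>y. norm (A *v y) \<le> b * norm y"
    using linear_bounded_pos[OF matrix_vector_mul_linear[of A]] by blast
  have aff: "b-lipschitz_on (cball x0 r) (\<lambda>x. p + A *v (x - x0))"
  proof (rule lipschitz_onI)
    fix x y
    have "p + A *v (x - x0) - (p + A *v (y - x0)) = A *v (x - y)"
      by (simp add: matrix_vector_mult_diff_distrib)
    then show "dist (p + A *v (x - x0)) (p + A *v (y - x0)) \<le> b * dist x y"
      using b(2)[of "x - y"] by (simp add: dist_norm)
  qed (use b in auto)
  have "(B * b)-lipschitz_on (cball x0 r) (\<lambda>x. f' (norm (p + A *v (x - x0))) / norm (p + A *v (x - x0)))"
  proof (rule lipschitz_onI)
    fix x y assume xy: "x \<in> cball x0 r" "y \<in> cball x0 r"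
    let ?q = "\<lambda>x. p + A *v (x - x0)"
    have "dist (f' (norm (?q x)) / norm (?q x)) (f' (norm (?q y)) / norm (?q y))
        \<le> B * dist (norm (?q x)) (norm (?q y))"
      using xy bounds by (intro lipschitz_onD[OF quot]) auto
    also have "dist (norm (?q x)) (norm (?q y)) \<le> dist (?q x) (?q y)"
      unfolding dist_real_def dist_norm[of "?q x"] by (rule norm_triangle_ineq3)
    also have "\<dots> \<le> b * dist x y" by (rule lipschitz_onD[OF aff xy])
    finally show "dist (f' (norm (?q x)) / norm (?q x)) (f' (norm (?q y)) / norm (?q y))
        \<le> B * b * dist x y" using B(1) by (simp add: mult.assoc)
  qed (use b B in auto)
  from lipschitz_on_scaleR_compact[OF this aff compact_cball]
  obtain C where "C-lipschitz_on (cball x0 r)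
      (\<lambda>x. (f' (norm (p + A *v (x - x0))) / norm (p + A *v (x - x0))) *\<^sub>R (p + A *v (x - x0)))" .
  then show ?thesis using that by (simp add: flux_def)
qed

text \<open>
  The energy is a Bochner integral, hence \<open>0\<close> by convention for integrands that are not integrable.
  Comparing energies therefore requires this lemma for both functions.
\<close>

lemma energy_integrable:
  fixes w :: "real^'n \<Rightarrow> real"
  assumes lip: "L-lipschitz_on S w" and "open S" "bounded S"
  shows "set_integrable lebesgue S (\<lambda>x. f (norm (gradient w x)))"
proof -
  obtain W where W: "L-lipschitz_on UNIV W" "\<And>x. x \<in> S \<Longrightarrow> W x = w x"
    using lipschitz_extension_UNIV[OF lip] by blast
  have grad: "gradient w x = gradient W x" if "x \<in> S" for x
    using W(2) by (intro gradient_cong_open[OF \<open>open S\<close> that]) auto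
  have f_cont: "continuous_on {0..} f"
    using deriv_f by (intro DERIV_continuous_on) auto
  have "continuous_on UNIV (\<lambda>r. f (max 0 r))"
    by (intro continuous_on_compose2[OF f_cont] continuous_intros) auto
  then have fm: "(\<lambda>r. f (max 0 r)) \<in> borel_measurable borel"
    by (rule borel_measurable_continuous_onI)
  have [measurable]: "gradient W \<in> borel_measurable lebesgue"
    by (rule gradient_measurable[OF W(1)])
  have "(\<lambda>x. norm (gradient W x)) \<in> borel_measurable lebesgue"
    by measurable
  from measurable_compose[OF this fm]
  have meas: "(\<lambda>x. f (norm (gradient W x))) \<in> borel_measurable lebesgue" by simp
  have "bounded (f ` {0..L})"
    using f_cont by (intro compact_imp_bounded compact_continuous_image) (auto intro: continuous_on_subset)
  then obtain B where B: "\<forall>r\<in>{0..L}. \<bar>f r\<bar> \<le> B" "0 < B"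
    unfolding bounded_pos by auto
  have S: "S \<in> lmeasurable" using \<open>open S\<close> \<open>bounded S\<close> by (rule lmeasurable_open[rotated])
  have "set_integrable lebesgue S (\<lambda>x. f (norm (gradient W x)))"
    unfolding set_integrable_def
  proof (rule Bochner_Integration.integrable_bound)
    show "integrable lebesgue (\<lambda>x. B * indicat_real S x)"
      using S by (intro integrable_mult_right integrable_real_indicator) (auto simp: fmeasurable_def)
    show "(\<lambda>x. indicat_real S x *\<^sub>R f (norm (gradient W x))) \<in> borel_measurable lebesgue"
      using meas S by (intro borel_measurable_scaleR borel_measurable_indicator) auto
    show "AE x in lebesgue. norm (indicat_real S x *\<^sub>R f (norm (gradient W x))) \<le> norm (B * indicat_real S x)"
      using B norm_gradient_le[OF W(1) open_UNIV] by (auto simp: indicator_def)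
  qed
  then show ?thesis
    by (rule set_integrable_cong[THEN iffD1, rotated -1]) (auto simp: grad)
qed

end

section \<open>Minimisers are viscosity subsolutions\<close>

lemma integral_pos_if_continuous:
  fixes v :: "'a::euclidean_space \<Rightarrow> real"
  assumes cont: "continuous_on UNIV v" and int: "integrable lebesgue v"
    and nonneg: "\<And>x. 0 \<le> v x" and pos: "0 < v x0"
  shows "0 < integral\<^sup>L lebesgue v"
proof -
  have "isCont v x0" using cont by (simp add: continuous_on_eq_continuous_at)
  then have "eventually (\<lambda>x. v x0 / 2 < v x) (at x0)"
    using pos unfolding isCont_def by (intro order_tendstoD(1)) auto
  then obtain d where d: "d > 0" "\<And>x. x \<noteq> x0 \<Longrightarrow> dist x x0 < d \<Longrightarrow> v x0 / 2 < v x"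
    unfolding eventually_at by auto
  have "0 < v x0 / 2 * measure lebesgue (ball x0 d)"
    using pos d(1) by (simp add: content_ball_pos)
  also have "\<dots> = integral\<^sup>L lebesgue (\<lambda>x. v x0 / 2 * indicat_real (ball x0 d) x)"
    by simp
  also have "\<dots> \<le> integral\<^sup>L lebesgue v"
  proof (rule integral_mono)
    show "integrable lebesgue (\<lambda>x. v x0 / 2 * indicat_real (ball x0 d) x)"
      using lmeasurable_ball[of x0 d]
      by (intro integrable_mult_right integrable_real_indicator) (auto simp: fmeasurable_def)
    show "v x0 / 2 * indicat_real (ball x0 d) x \<le> v x" for x
      using d(2)[of x] nonneg[of x] pos
      by (cases "x = x0") (auto simp: indicator_def dist_commute less_imp_le)
  qed (rule int)
  finally show ?thesis .
qed

lemma nonneg_if_perturbations_nonneg: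
  fixes a b :: real
  assumes "\<And>\<epsilon>. 0 < \<epsilon> \<Longrightarrow> 0 \<le> a + \<epsilon> * b"
  shows "0 \<le> a"
proof (rule tendsto_lowerbound)
  have "((\<lambda>\<epsilon>. a + \<epsilon> * b) \<longlongrightarrow> a + 0 * b) (at_right 0)" by (intro tendsto_intros)
  then show "((\<lambda>\<epsilon>. a + \<epsilon> * b) \<longlongrightarrow> a) (at_right 0)" by simp
  show "\<forall>\<^sub>F \<epsilon> in at_right 0. 0 \<le> a + \<epsilon> * b"
    using eventually_at_right_less by eventually_elim (rule assms)
qed simp

context integrand
begin

text \<open>
  The cut-off argument. Strict touching is quantified by \<open>\<eta>\<close>, which decides how far the paraboloid can be
  lowered before the cut-off set leaves the ball.
\<close>

lemma minimizer_touched_from_above: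
  fixes u psi :: "real^'n \<Rightarrow> real" and p x0 :: "real^'n" and A :: "real^'n^'n"
  assumes "open Omega" "bounded Omega" and min: "solves_min_problem f Omega psi u"
    and "x0 \<in> Omega" "p \<noteq> 0" and sym: "transpose A = A" and "0 < \<eta>"
    and touch: "\<forall>\<^sub>F x in at x0. u x \<le> u x0 + p \<bullet> (x - x0) + (A *v (x - x0)) \<bullet> (x - x0) / 2
        - \<eta> * (norm (x - x0))\<^sup>2"
  shows "0 \<le> (alpha f' f'' (norm p) - 1) * ((A *v p) \<bullet> p) + (norm p)\<^sup>2 * trace A"
proof (rule ccontr)
  assume "\<not> ?thesis"
  then have neg: "(alpha f' f'' (norm p) - 1) * ((A *v p) \<bullet> p) + (norm p)\<^sup>2 * trace A < 0" by simp
  have p_pos: "0 < norm p" using \<open>p \<noteq> 0\<close> by simp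
  define q where "q x = p + A *v (x - x0)" for x
  define P where "P x = u x0 + p \<bullet> (x - x0) + (A *v (x - x0)) \<bullet> (x - x0) / 2" for x
  \<comment> \<open>The divergence of the flux of \<open>P\<close>, where \<open>q\<close> is the gradient of \<open>P\<close>.\<close>
  define D where "D x = (f' (norm (q x)) / norm (q x)) * trace A +
    (f'' (norm (q x)) / norm (q x) - f' (norm (q x)) / (norm (q x))\<^sup>2) / norm (q x) * ((A *v q x) \<bullet> q x)" for x
  have q0: "q x0 = p" by (simp add: q_def)
  have q_cont: "isCont q x" for x
    unfolding q_def by (intro continuous_intros
        bounded_linear.isCont[OF matrix_vector_mul_bounded_linear])
  have "D x0 = f' (norm p) / norm p ^ 3 *
      ((alpha f' f'' (norm p) - 1) * ((A *v p) \<bullet> p) + (norm p)\<^sup>2 * trace A)"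
    using p_pos f'_pos[OF p_pos] unfolding D_def q0 alpha_def
    by (simp add: field_simps power2_eq_square power3_eq_cube)
  then have D0: "D x0 < 0"
    using neg f'_pos[OF p_pos] p_pos by (simp only:) (intro mult_pos_neg divide_pos_pos; simp)
  have "isCont D x0"
    unfolding D_def using p_pos
    by (intro continuous_intros isCont_o2[OF _ isCont_f'] isCont_o2[OF _ isCont_f''] q_cont
        bounded_linear.isCont[OF matrix_vector_mul_bounded_linear]) (auto simp: q0)
  then have ev1: "\<forall>\<^sub>F x in at x0. D x < D x0 / 2"
    using D0 unfolding isCont_def by (intro order_tendstoD(2)) auto
  have "((\<lambda>x. norm (q x)) \<longlongrightarrow> norm (q x0)) (at x0)"
    using q_cont[of x0] unfolding isCont_def by (rule tendsto_norm)
  then have lim_q: "((\<lambda>x. norm (q x)) \<longlongrightarrow> norm p) (at x0)" by (simp only: q0)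
  have ev2: "\<forall>\<^sub>F x in at x0. norm p / 2 < norm (q x)" "\<forall>\<^sub>F x in at x0. norm (q x) < 2 * norm p"
    by (rule order_tendstoD[OF lim_q]; use p_pos in simp)+
  have ev3: "\<forall>\<^sub>F x in at x0. x \<in> Omega"
    using \<open>open Omega\<close> \<open>x0 \<in> Omega\<close> by (intro eventually_at_in_open') auto
  have "\<forall>\<^sub>F x in at x0. D x < D x0 / 2 \<and> norm p / 2 < norm (q x) \<and> norm (q x) < 2 * norm p \<and>
      x \<in> Omega \<and> u x \<le> P x - \<eta> * (norm (x - x0))\<^sup>2"
    using ev1 ev2 ev3 touch by eventually_elim (simp add: P_def)
  then obtain d where d: "d > 0" "\<And>x. x \<noteq> x0 \<Longrightarrow> dist x x0 < d \<Longrightarrow>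
      D x < D x0 / 2 \<and> norm p / 2 < norm (q x) \<and> norm (q x) < 2 * norm p \<and>
      x \<in> Omega \<and> u x \<le> P x - \<eta> * (norm (x - x0))\<^sup>2"
    unfolding eventually_at by auto
  define r where "r = d / 2"
  have "0 < r" using d(1) by (simp add: r_def)
  have near: "D x \<le> D x0 / 2" "norm p / 2 \<le> norm (q x)" "norm (q x) \<le> 2 * norm p"
    "x \<in> Omega" "u x \<le> P x - \<eta> * (norm (x - x0))\<^sup>2" if "x \<in> cball x0 r" for x
  proof -
    have "dist x x0 < d" using that d(1) by (simp add: r_def dist_commute)
    then show "D x \<le> D x0 / 2" "norm p / 2 \<le> norm (q x)" "norm (q x) \<le> 2 * norm p"
      "x \<in> Omega" "u x \<le> P x - \<eta> * (norm (x - x0))\<^sup>2"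
      using d(2)[of x] D0 p_pos \<open>x0 \<in> Omega\<close> by (cases "x = x0"; auto simp: q0 P_def)+
  qed
  \<comment> \<open>At distance at least \<open>r / 2\<close> from \<open>x0\<close> the gap between \<open>P\<close> and \<open>u\<close> is at least \<open>\<eta> r\<^sup>2 / 4 > \<delta>\<close>, so \<open>v\<close> vanishes
    there.\<close>
  define \<delta> where "\<delta> = \<eta> * r\<^sup>2 / 8"
  have "0 < \<delta>" using \<open>0 < \<eta>\<close> \<open>0 < r\<close> by (simp add: \<delta>_def)
  define v where "v x = (if x \<in> cball x0 r then max 0 (u x - P x + \<delta>) else 0)" for x
  have v_nonneg: "0 \<le> v x" for x by (simp add: v_def)
  have v_x0: "v x0 = \<delta>" using \<open>0 < r\<close> \<open>0 < \<delta>\<close> by (simp add: v_def P_def)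
  have v_supp: "v x = 0" if "x \<notin> cball x0 (r / 2)" for x
  proof (cases "x \<in> cball x0 r")
    case True
    have "(r / 2)\<^sup>2 \<le> (norm (x - x0))\<^sup>2"
      using that \<open>0 < r\<close> by (intro power_mono) (auto simp: dist_norm norm_minus_commute)
    then have "\<eta> * (r / 2)\<^sup>2 \<le> \<eta> * (norm (x - x0))\<^sup>2" using \<open>0 < \<eta>\<close> by simp
    moreover have "\<delta> \<le> \<eta> * (r / 2)\<^sup>2" using \<open>0 < \<eta>\<close> by (simp add: \<delta>_def power2_eq_square)
    ultimately show ?thesis using near(5)[OF True] by (simp add: v_def)
  qed (simp add: v_def)
  have P_deriv: "(P has_derivative (\<lambda>h. h \<bullet> q x)) (at x within S)" for x S
  proof -
    have lin: "((\<lambda>x. A *v (x - x0)) has_derivative (\<lambda>h. A *v h)) (at x within S)"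
      by (rule bounded_linear.has_derivative[OF matrix_vector_mul_bounded_linear])
        (auto intro!: derivative_eq_intros)
    have A_sym: "(A *v y) \<bullet> z = y \<bullet> (A *v z)" for y z
      by (metis dot_lmul_matrix sym transpose_matrix_vector)
    show ?thesis unfolding P_def[abs_def] q_def
      by (auto intro!: derivative_eq_intros lin simp: inner_add_right A_sym inner_commute)
  qed
  obtain L where L: "L-lipschitz_on (closure Omega) u"
    using min by (auto simp: solves_min_problem_def lip_competitors_def)
  have P_lip: "(2 * norm p)-lipschitz_on (cball x0 r) P"
  proof (rule bounded_derivative_imp_lipschitz[OF P_deriv])
    fix x assume x: "x \<in> cball x0 r"
    have "onorm (\<lambda>h. h \<bullet> q x) \<le> norm (q x)"
      by (rule onorm_le) (metis Cauchy_Schwarz_ineq2 mult.commute real_norm_def)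
    then show "onorm (\<lambda>h. h \<bullet> q x) \<le> 2 * norm p" using near(3)[OF x] by simp
  qed auto
  have cball_Omega: "cball x0 r \<subseteq> Omega" using near(4) by blast
  have "(L + 2 * norm p)-lipschitz_on (cball x0 r) v"
  proof (rule lipschitz_onI)
    fix x y assume xy: "x \<in> cball x0 r" "y \<in> cball x0 r"
    have "\<bar>max 0 a - max 0 b\<bar> \<le> \<bar>a - b\<bar>" for a b :: real by linarith
    then have "dist (v x) (v y) \<le> \<bar>(u x - P x + \<delta>) - (u y - P y + \<delta>)\<bar>"
      using xy by (simp only: v_def dist_real_def if_True)
    also have "\<dots> \<le> \<bar>u x - u y\<bar> + \<bar>P x - P y\<bar>" by linarith
    also have "\<dots> \<le> L * dist x y + 2 * norm p * dist x y"
    proof (rule add_mono)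
      have "x \<in> closure Omega" "y \<in> closure Omega" using xy cball_Omega closure_subset by blast+
      then show "\<bar>u x - u y\<bar> \<le> L * dist x y" using lipschitz_onD[OF L] by (simp add: dist_real_def)
      show "\<bar>P x - P y\<bar> \<le> 2 * norm p * dist x y"
        using lipschitz_onD[OF P_lip xy] by (simp add: dist_real_def)
    qed
    finally show "dist (v x) (v y) \<le> (L + 2 * norm p) * dist x y" by (simp add: algebra_simps)
  qed (use lipschitz_on_nonneg[OF L] in simp)
  then obtain K where K: "K-lipschitz_on UNIV v"
    using lipschitz_on_UNIV_if_compactly_supported \<open>0 < r\<close> v_supp by blast
  have v_cont: "continuous_on UNIV v" by (rule lipschitz_on_continuous_on[OF K])
  have "integrable lborel v" using v_cont v_supp by (rule integrable_compactly_supported)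
  then have v_int: "integrable lebesgue v" by (subst integrable_completion) auto
  have v_Omega: "v x = 0" if "x \<notin> Omega" for x
    using that cball_Omega by (auto simp: v_def)
  define w where "w x = u x - v x" for x
  have w_lip: "(L + K)-lipschitz_on (closure Omega) w"
    unfolding w_def by (intro lipschitz_on_diff L lipschitz_on_subset[OF K]) auto
  have "w \<in> lip_competitors Omega psi"
  proof -
    have "w x = psi x" if x: "x \<in> frontier Omega" for x
    proof -
      have "x \<notin> Omega" using x \<open>open Omega\<close> by (simp add: frontier_def interior_open)
      then show ?thesis using x min v_Omega
        by (simp add: w_def solves_min_problem_def lip_competitors_def)
    qed
    then show ?thesis using w_lip unfolding lip_competitors_def by blast
  qed
  then have "energy f Omega u \<le> energy f Omega w" using min by (simp add: solves_min_problem_def)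
  obtain C where C: "C-lipschitz_on (cball x0 r) (\<lambda>x. flux (q x))"
    using flux_affine_lipschitz[of x0 r p A "norm p / 2" "2 * norm p"] near(2,3) p_pos
    unfolding q_def by auto
  have q_nz: "q x \<noteq> 0" if "x \<in> cball x0 r" for x using near(2)[OF that] p_pos by auto
  have flux_q: "((\<lambda>x. flux (q x)) has_derivative (\<lambda>h. flux_derivative (q x) (A *v h))) (at x)"
    if "x \<in> ball x0 r" for x
  proof -
    have "(q has_derivative (\<lambda>h. A *v h)) (at x)" unfolding q_def[abs_def]
      by (auto intro!: derivative_eq_intros bounded_linear.has_derivative[OF matrix_vector_mul_bounded_linear])
    then show ?thesis
      using q_nz[of x] that by (intro has_derivative_compose[OF _ flux_has_derivative]) auto
  qed
  obtain g where g: "integrable lebesgue g" "integral\<^sup>L lebesgue g = 0" "\<And>x. x \<notin> ball x0 r \<Longrightarrow> g x = 0"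
    "AE x in lebesgue. x \<in> ball x0 r \<longrightarrow> g x = gradient v x \<bullet> flux (q x) +
       v x * (\<Sum>i\<in>Basis. flux_derivative (q x) (A *v i) \<bullet> i)"
    using weak_divergence_theorem[OF K v_supp \<open>0 < r\<close> C flux_q] by blast
  define c where "c = - D x0 / 2"
  have "0 < c" using D0 by (simp add: c_def)
  have pointwise: "AE x in lebesgue. x \<in> Omega \<longrightarrow>
      f (norm (gradient w x)) + c * v x + g x \<le> f (norm (gradient u x))"
    using g(4) AE_lebesgue_differentiable[OF K]
  proof eventually_elim
    case (elim x)
    show ?case
    proof
      assume "x \<in> Omega"
      show "f (norm (gradient w x)) + c * v x + g x \<le> f (norm (gradient u x))"
      \<comment> \<open>Where \<open>v\<close> vanishes it is minimal, so \<open>u\<close> and \<open>w\<close> have the same gradient, also in the case that neither is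
        differentiable and both gradients are \<open>0\<close> by definition. Where \<open>v > 0\<close>, near \<open>x\<close> the competitor is
        \<open>P - \<delta>\<close> and convexity applies.\<close>
      proof (cases "v x = 0")
        case True
        have "gradient v x = 0"
          using elim(2) True v_nonneg by (intro differentiable_zero_gradient_at_min) auto
        then have v': "(v has_derivative (\<lambda>h. 0)) (at x)"
          using GDERIV_gradient[OF elim(2)] by (simp add: gderiv_def)
        have "g x = 0" using elim(1) g(3)[of x] True \<open>gradient v x = 0\<close> by (cases "x \<in> ball x0 r") auto
        moreover have "gradient w x = gradient u x"
        proof (cases "u differentiable (at x)")
          case True
          then have "(u has_derivative (\<lambda>h. h \<bullet> gradient u x)) (at x)"
            using GDERIV_gradient by (simp add: gderiv_def)
          then have "(w has_derivative (\<lambda>h. h \<bullet> gradient u x)) (at x)"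
            unfolding w_def[abs_def] using has_derivative_diff[OF _ v'] by force
          then show ?thesis by (intro gradient_eqI) (simp add: gderiv_def)
        next
          case False
          have "\<not> w differentiable (at x)"
          proof
            assume "w differentiable (at x)"
            then have "(\<lambda>x. w x + v x) differentiable (at x)" using elim(2) by (rule differentiable_add)
            then show False using False by (simp add: w_def)
          qed
          then show ?thesis using False by (simp add: gradient_def)
        qed
        ultimately show ?thesis using True by simp
      next
        case False
        then have "0 < v x" using v_nonneg[of x] by simp
        have x_ball: "x \<in> ball x0 r"
        proof -
          have "x \<in> cball x0 (r / 2)" using v_supp[of x] False by blast
          then show ?thesis using \<open>0 < r\<close> by auto
        qed
        let ?S = "ball x0 r \<inter> {y. 0 < v y}"
        have "open ?S" by (intro open_Int open_ball open_Collect_less v_cont continuous_intros)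
        moreover have "x \<in> ?S" using x_ball \<open>0 < v x\<close> by simp
        moreover have wP: "w y = P y - \<delta>" if "y \<in> ?S" for y
          using that by (auto simp: w_def v_def max_def split: if_splits)
        moreover have uP: "u y = P y - \<delta> + v y" if "y \<in> ?S" for y
          using wP[OF that] by (simp add: w_def)
        moreover have P\<delta>: "((\<lambda>y. P y - \<delta>) has_derivative (\<lambda>h. h \<bullet> q x)) (at x)"
          using has_derivative_diff[OF P_deriv has_derivative_const] by force
        ultimately have "gradient w x = gradient (\<lambda>y. P y - \<delta>) x"
          "gradient u x = gradient (\<lambda>y. P y - \<delta> + v y) x"
          by (blast intro: gradient_cong_open)+
        moreover have "gradient (\<lambda>y. P y - \<delta>) x = q x"
          using P\<delta> by (intro gradient_eqI) (simp add: gderiv_def)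
        moreover have "gradient (\<lambda>y. P y - \<delta> + v y) x = q x + gradient v x"
          using has_derivative_add[OF P\<delta> GDERIV_gradient[OF elim(2), unfolded gderiv_def]]
          by (intro gradient_eqI) (simp add: gderiv_def inner_add_right)
        ultimately have grads: "gradient w x = q x" "gradient u x = q x + gradient v x" by simp_all
        have x_cball: "x \<in> cball x0 r" using x_ball by simp
        have "g x = gradient v x \<bullet> flux (q x) + v x * D x"
          using elim(1) x_ball by (simp add: sum_flux_derivative D_def)
        moreover have "v x * D x \<le> v x * (- c)"
          using near(1)[OF x_cball] v_nonneg[of x] by (intro mult_left_mono) (auto simp: c_def)
        ultimately show ?thesis
          using density_above_tangent[OF q_nz[OF x_cball], of "gradient u x"] unfolding grads
          by (simp add: inner_commute mult.commute)
      qed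
    qed
  qed
  have u_lip: "L-lipschitz_on Omega u" using L closure_subset by (rule lipschitz_on_subset)
  have w_lip': "(L + K)-lipschitz_on Omega w" using w_lip closure_subset by (rule lipschitz_on_subset)
  note int_u = energy_integrable[OF u_lip assms(1,2), unfolded set_integrable_def]
  note int_w = energy_integrable[OF w_lip' assms(1,2), unfolded set_integrable_def]
  let ?I = "indicat_real Omega"
  have "integral\<^sup>L lebesgue (\<lambda>x. ?I x *\<^sub>R f (norm (gradient w x)) + (c * v x + g x))
      \<le> integral\<^sup>L lebesgue (\<lambda>x. ?I x *\<^sub>R f (norm (gradient u x)))"
  proof (rule integral_mono_AE)
    show "AE x in lebesgue. ?I x *\<^sub>R f (norm (gradient w x)) + (c * v x + g x)
        \<le> ?I x *\<^sub>R f (norm (gradient u x))"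
      using pointwise
    proof eventually_elim
      case (elim x)
      show ?case
      proof (cases "x \<in> Omega")
        case False
        then have "x \<notin> ball x0 r" using cball_Omega ball_subset_cball by blast
        then have "g x = 0" by (rule g(3))
        then show ?thesis using False v_Omega by simp
      qed (use elim in simp)
    qed
  qed (intro Bochner_Integration.integrable_add integrable_mult_right int_u int_w v_int g(1))+
  also have "integral\<^sup>L lebesgue (\<lambda>x. ?I x *\<^sub>R f (norm (gradient w x)) + (c * v x + g x)) =
      energy f Omega w + c * integral\<^sup>L lebesgue v"
    using int_w v_int g(1,2) by (simp add: energy_def set_lebesgue_integral_def)
  finally have "energy f Omega w + c * integral\<^sup>L lebesgue v \<le> energy f Omega u"
    by (simp add: energy_def set_lebesgue_integral_def)
  moreover have "0 < integral\<^sup>L lebesgue v"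
    using v_x0 \<open>0 < \<delta>\<close> by (intro integral_pos_if_continuous[OF v_cont v_int v_nonneg, of x0]) simp
  ultimately show False using \<open>energy f Omega u \<le> energy f Omega w\<close> \<open>0 < c\<close>
    by (smt (verit) mult_pos_pos)
qed

text \<open>
  An arbitrary test function is replaced by its quadratic Taylor polynomial with \<open>\<epsilon>/2\<close> times the squared distance
  added, half of which absorbs the Taylor remainder and half of which makes the contact strict;
  then \<open>\<epsilon>\<close> tends to \<open>0\<close>. Symmetrising the Hessian changes neither its quadratic form nor its trace.
\<close>

lemma minimizer_viscosity_subsolution:
  fixes u psi :: "real^'n \<Rightarrow> real"
  assumes "open Omega" "bounded Omega" and min: "solves_min_problem f Omega psi u"
  shows "viscosity_subsolution Omega
    (\<lambda>p X. - (alpha f' f'' (norm p) - 1) * ((X *v p) \<bullet> p) - (norm p)\<^sup>2 * trace X) u"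
  unfolding viscosity_subsolution_def
proof (intro conjI allI impI)
  obtain L where L: "L-lipschitz_on (closure Omega) u"
    using min by (auto simp: solves_min_problem_def lip_competitors_def)
  have "continuous_on Omega u"
    using lipschitz_on_continuous_on[OF L] closure_subset by (rule continuous_on_subset)
  then show "upper_semicontinuous_on Omega u"
    unfolding upper_semicontinuous_on_def continuous_on_def by (auto intro: order_tendstoD)
next
  fix phi x0 assume *: "C2_on Omega phi \<and> local_max_in Omega (\<lambda>y. u y - phi y) x0"
  let ?p = "gradient phi x0" and ?X = "hessian phi x0"
  let ?a = "alpha f' f'' (norm ?p) - 1"
  have x0: "x0 \<in> Omega" using * by (simp add: local_max_in_def)
  have max: "\<forall>\<^sub>F y in at x0. u y - phi y \<le> u x0 - phi x0"
    using * at_within_open[OF x0 \<open>open Omega\<close>] by (simp add: local_max_in_def)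
  show "- ?a * ((?X *v ?p) \<bullet> ?p) - (norm ?p)\<^sup>2 * trace ?X \<le> 0"
  proof (cases "?p = 0")
    case False
    let ?E = "?a * ((?X *v ?p) \<bullet> ?p) + (norm ?p)\<^sup>2 * trace ?X"
    let ?b = "?a * (norm ?p)\<^sup>2 + (norm ?p)\<^sup>2 * CARD('n)"
    have perturbed: "0 \<le> ?E + \<epsilon> * ?b" if "0 < \<epsilon>" for \<epsilon>
    proof -
      define A where "A = (1 / 2) *\<^sub>R (?X + transpose ?X) + \<epsilon> *\<^sub>R mat 1"
      have quad: "(A *v h) \<bullet> h = (?X *v h) \<bullet> h + \<epsilon> * (norm h)\<^sup>2" for h
      proof -
        have "(transpose ?X *v h) \<bullet> h = (?X *v h) \<bullet> h"
          unfolding transpose_matrix_vector dot_lmul_matrix by (rule inner_commute)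
        then show ?thesis
          by (simp add: A_def matrix_vector_mult_add_rdistrib scaleR_matrix_vector_assoc[symmetric]
              inner_add_left dot_square_norm)
      qed
      have tr: "trace A = trace ?X + \<epsilon> * CARD('n)"
        by (simp add: A_def trace_def transpose_def sum.distrib mat_def)
      have "\<forall>\<^sub>F x in at x0. \<bar>phi x - (phi x0 + ?p \<bullet> (x - x0) + (?X *v (x - x0)) \<bullet> (x - x0) / 2)\<bar>
          \<le> \<epsilon> / 4 * (norm (x - x0))\<^sup>2"
        using * x0 \<open>0 < \<epsilon>\<close> by (intro second_order_taylor[OF \<open>open Omega\<close> x0]) (auto simp: C2_on_def)
      with max have "\<forall>\<^sub>F x in at x0. u x \<le> u x0 + ?p \<bullet> (x - x0) + (A *v (x - x0)) \<bullet> (x - x0) / 2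
          - \<epsilon> / 4 * (norm (x - x0))\<^sup>2"
      proof eventually_elim
        case (elim x)
        then show ?case unfolding quad abs_le_iff add_divide_distrib by argo
      qed
      then have "0 \<le> ?a * ((A *v ?p) \<bullet> ?p) + (norm ?p)\<^sup>2 * trace A"
        using \<open>0 < \<epsilon>\<close> False
        by (intro minimizer_touched_from_above[OF assms x0, where \<eta> = "\<epsilon> / 4"])
          (auto simp: A_def transpose_def vec_eq_iff mat_def)
      then show ?thesis unfolding quad tr by (simp add: algebra_simps)
    qed
    have "0 \<le> ?E" by (rule nonneg_if_perturbations_nonneg) (rule perturbed)
    then show ?thesis by (simp add: algebra_simps)
  qed simp
qed

end

section \<open>The reflected problem and supersolutions\<close>

lemma gradient_uminus:
  fixes w :: "real^'n \<Rightarrow> real"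
  shows "gradient (\<lambda>x. - w x) x = - gradient w x"
proof (cases "w differentiable (at x)")
  case True
  then show ?thesis by (intro gradient_eqI GDERIV_minus GDERIV_gradient)
next
  case False
  have "\<not> (\<lambda>x. - w x) differentiable (at x)"
  proof
    assume "(\<lambda>x. - w x) differentiable (at x)"
    then have "(\<lambda>x. - (- w x)) differentiable (at x)" by (rule differentiable_minus)
    then show False using False by simp
  qed
  then show ?thesis using False by (simp add: gradient_def)
qed

lemma hessian_uminus:
  fixes w :: "real^'n \<Rightarrow> real"
  assumes "gradient w differentiable (at x)"
  shows "hessian (\<lambda>x. - w x) x = - hessian w x"
proof -
  have "gradient (\<lambda>x. - w x) = (\<lambda>x. - gradient w x)" by (rule ext) (rule gradient_uminus)
  moreover have "frechet_derivative (\<lambda>x. - gradient w x) (at x) = (\<lambda>h. - frechet_derivative (gradient w) (at x) h)"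
    using has_derivative_minus[OF frechet_derivative_works[THEN iffD1, OF assms]]
    by (rule frechet_derivative_at[symmetric])
  ultimately show ?thesis
    by (simp add: hessian_def jacobian_def matrix_def vec_eq_iff)
qed

lemma solves_min_problem_uminus:
  fixes u psi :: "real^'n \<Rightarrow> real"
  assumes "solves_min_problem f Omega psi u"
  shows "solves_min_problem f Omega (\<lambda>x. - psi x) (\<lambda>x. - u x)"
proof -
  have energy: "energy f Omega (\<lambda>x. - w x) = energy f Omega w" for w :: "real^'n \<Rightarrow> real"
    by (simp add: energy_def gradient_uminus)
  have "(\<lambda>x. - w x) \<in> lip_competitors Omega psi" if "w \<in> lip_competitors Omega (\<lambda>x. - psi x)" for w
    using that by (auto simp: lip_competitors_def)
  then have "energy f Omega (\<lambda>x. - u x) \<le> energy f Omega w" if "w \<in> lip_competitors Omega (\<lambda>x. - psi x)" for w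
    using assms that energy[of w] energy[of u] unfolding solves_min_problem_def by metis
  moreover have "(\<lambda>x. - u x) \<in> lip_competitors Omega (\<lambda>x. - psi x)"
    using assms by (auto simp: solves_min_problem_def lip_competitors_def)
  ultimately show ?thesis by (simp add: solves_min_problem_def)
qed

text \<open>
  Reflection \<open>u \<mapsto> -u\<close> exchanges touching from below with touching from above, and negates the gradient and the
  Hessian of the test function.
\<close>

lemma viscosity_supersolution_if_uminus_subsolution:
  fixes u :: "real^'n \<Rightarrow> real"
  assumes odd: "\<And>p X. F (- p) (- X) = - F p X"
    and sub: "viscosity_subsolution S F (\<lambda>x. - u x)"
  shows "viscosity_supersolution S F u"
  unfolding viscosity_supersolution_def
proof (intro conjI allI impI)
  show "lower_semicontinuous_on S u"
    unfolding lower_semicontinuous_on_def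
  proof (intro ballI allI impI)
    fix x c assume "x \<in> S" "c < u x"
    then have "eventually (\<lambda>y. - u y < - c) (at x within S)"
      using sub unfolding viscosity_subsolution_def upper_semicontinuous_on_def
      by (metis neg_less_iff_less)
    then show "eventually (\<lambda>y. c < u y) (at x within S)" by simp
  qed
next
  fix phi x assume *: "C2_on S phi \<and> local_min_in S (\<lambda>y. u y - phi y) x"
  have grad: "gradient (\<lambda>x. - phi x) = (\<lambda>x. - gradient phi x)"
    by (rule ext) (rule gradient_uminus)
  have hess: "hessian (\<lambda>x. - phi x) y = - hessian phi y" if "y \<in> S" for y
    using * that by (intro hessian_uminus) (simp add: C2_on_def)
  have "continuous_on S (\<lambda>y. - hessian phi y)"
    using * by (intro continuous_on_minus) (simp add: C2_on_def)
  then have "continuous_on S (hessian (\<lambda>x. - phi x))"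
    by (simp add: hess cong: continuous_on_cong)
  then have "C2_on S (\<lambda>x. - phi x)"
    using * unfolding C2_on_def grad by (simp add: differentiable_minus)
  moreover have "local_max_in S (\<lambda>y. - u y - - phi y) x"
    using * by (auto simp: local_max_in_def local_min_in_def elim!: eventually_mono)
  ultimately have "F (gradient (\<lambda>x. - phi x) x) (hessian (\<lambda>x. - phi x) x) \<le> 0"
    using sub unfolding viscosity_subsolution_def by blast
  moreover have "x \<in> S" using * by (simp add: local_min_in_def)
  ultimately show "0 \<le> F (gradient phi x) (hessian phi x)" by (simp add: grad hess odd)
qed

theorem theorem3p7:
  fixes Omega :: "(real^'n) set"
    and psi u :: "real^'n \<Rightarrow> real"
    and f f' f'' :: "real \<Rightarrow> real"
    and Q lam l0 linf :: real
  assumes "open Omega" "connected Omega" "Omega \<noteq> {}" "bounded Omega"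
    and "continuous_on (frontier Omega) psi"
    and "Q > 0" "bounded_slope_condition Q Omega psi"
    and "strictly_convex_on {0..} f"
    and "\<And>r. r \<ge> 0 \<Longrightarrow> (f has_real_derivative f' r) (at r within {0..})"
    and "continuous_on {0..} f'"
    and "\<And>r. r > 0 \<Longrightarrow> (f' has_real_derivative f'' r) (at r)"
    and "0 < lam" "lam < 1" "locally_holder_on lam {0<..} f''"
    and "f' 0 > 0"
    and "((\<lambda>r. r * f'' r / f' r) \<longlongrightarrow> l0) (at_right 0)"
    and "((\<lambda>r. r * f'' r / f' r) \<longlongrightarrow> linf) at_top" "linf > 0"
    and "solves_min_problem f Omega psi u"
  shows "viscosity_solution Omega
           (\<lambda>p X. - (alpha f' f'' (norm p) - 1) * ((X *v p) \<bullet> p) - (norm p)\<^sup>2 * trace X) u"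
proof -
  interpret integrand f f' f'' lam
    using assms by unfold_locales
  have "trace (- X) = - trace X" for X :: "real^'n^'n" by (simp add: trace_def sum_negf)
  moreover have "((- X) *v (- p)) \<bullet> (- p) = - ((X *v p) \<bullet> p)" for X :: "real^'n^'n" and p
    by (simp add: matrix_vector_mult_def inner_vec_def sum_negf)
  ultimately have odd: "- (alpha f' f'' (norm (- p)) - 1) * ((- X *v - p) \<bullet> - p) - (norm (- p))\<^sup>2 * trace (- X)
      = - (- (alpha f' f'' (norm p) - 1) * ((X *v p) \<bullet> p) - (norm p)\<^sup>2 * trace X)"
    for p :: "real^'n" and X :: "real^'n^'n" by simp
  show ?thesis
    unfolding viscosity_solution_def
  proof
    show "viscosity_subsolution Omega
        (\<lambda>p X. - (alpha f' f'' (norm p) - 1) * ((X *v p) \<bullet> p) - (norm p)\<^sup>2 * trace X) u"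
      using assms(1,4,19) by (rule minimizer_viscosity_subsolution)
    show "viscosity_supersolution Omega
        (\<lambda>p X. - (alpha f' f'' (norm p) - 1) * ((X *v p) \<bullet> p) - (norm p)\<^sup>2 * trace X) u"
    proof (rule viscosity_supersolution_if_uminus_subsolution, rule odd)
      show "viscosity_subsolution Omega
          (\<lambda>p X. - (alpha f' f'' (norm p) - 1) * ((X *v p) \<bullet> p) - (norm p)\<^sup>2 * trace X) (\<lambda>x. - u x)"
        using assms(1,4) solves_min_problem_uminus[OF assms(19)]
        by (rule minimizer_viscosity_subsolution)
    qed
  qed
qed

end
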